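(* Let $n>3$, $q\ge2$, and let $H$ be a periodic $C^2$ curve in $\mathbb{R}^n$. Define $G:\mathbb{R}^n\setminus\mathrm{Im}(H)\to\mathbb{R}$ by $G(x)=\int_0^1\frac{1}{|x-H(t)|^{q-1}}\,dt$. If $H$ is an embedding, then there exists a bounded open set $U\subseteq\mathbb{R}^n$ such that $\mathrm{Im}(H)\subseteq U$ and $\deg(\nabla G,\partial U,0)=0$.
   Context: $H:[0,1]\to\mathbb{R}^n$ satisfies $H(0)=H(1)$, $H'(0)=H'(1)$ and is regarded as a map $S^1\to\mathbb{R}^n$; embedding means this map is injective with nowhere vanishing derivative. If $U\subset\mathbb{R}^n$ is open and bounded and $\phi:\partial U\to\mathbb{R}^n\setminus\{0\}$ is continuous, then $\deg(\phi,\partial U,0):=\deg(\hat\phi,U,0)$ (Brouwer degree), where $\hat\phi:\overline U\to\mathbb{R}^n$ is any continuous extension of $\phi$. It is part of the conclusion that $\nabla G\ne0$ on $\partial U$. *)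

theory Defs
  imports "HOL-Analysis.Analysis" "HOL-Homology.Homology"
begin

definition periodic_C2_curve :: "(real \<Rightarrow> 'a::real_normed_vector) \<Rightarrow> bool" where
  "periodic_C2_curve H \<longleftrightarrow>
     (\<exists>H' H''.
        (\<forall>t\<in>{0..1}. (H has_vector_derivative H' t) (at t within {0..1})) \<and>
        (\<forall>t\<in>{0..1}. (H' has_vector_derivative H'' t) (at t within {0..1})) \<and>
        continuous_on {0..1} H'' \<and>
        H 0 = H 1 \<and> H' 0 = H' 1)"

(* loop_free is injectivity of the induced map on the circle obtained from [0,1] by
   identifying 0 and 1. *)
definition embedded_closed_curve :: "(real \<Rightarrow> 'a::real_normed_vector) \<Rightarrow> bool" where
  "embedded_closed_curve H \<longleftrightarrow>
     loop_free H \<and> (\<forall>t\<in>{0..1}. vector_derivative H (at t within {0..1}) \<noteq> 0)"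

(* Only the values at points x off the curve are meaningful. *)
definition curve_potential ::
    "real \<Rightarrow> (real \<Rightarrow> 'a::real_normed_vector) \<Rightarrow> 'a \<Rightarrow> real" where
  "curve_potential q H x = integral {0..1} (\<lambda>t. 1 / (norm (x - H t) powr (q - 1)))"

definition gradient :: "('a::real_inner \<Rightarrow> real) \<Rightarrow> 'a \<Rightarrow> 'a" where
  "gradient f x = (THE D. GDERIV f x :> D)"

(* The Brouwer degree deg(f,U,p), for U open and bounded, f continuous on the closure of U
   and p not in f(frontier U), in its homological form (A. Dold, Lectures on Algebraic
   Topology, VIII.4).  Put n = CARD('n) and let K be the set of solutions of f x = p in U,
   which is compact.  Consider

     H_n(R^n, R^n - B) --> H_n(R^n, R^n - K) <-- H_n(U, U - K) --> H_n(R^n, R^n - p)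
             c                                        u              f_* u

   where B is a closed ball containing K and p, and the first two arrows are induced by
   inclusions; the second one is an isomorphism by excision.  If u corresponds to c, then
   f_* u is deg(f,U,p) times the image of c under the inclusion-induced isomorphism
   H_n(R^n, R^n - B) --> H_n(R^n, R^n - p), both groups being infinite cyclic.  As c is used
   on both sides, no orientation has to be chosen; the identity has degree 1 at each p in U.
   The homology groups are written multiplicatively. *)
definition brouwer_degree ::
    "(real^'n \<Rightarrow> real^'n) \<Rightarrow> (real^'n) set \<Rightarrow> real^'n \<Rightarrow> int" where
  "brouwer_degree f U p =
     (let n = int CARD('n); K = {x \<in> U. f x = p} in
      THE d. \<forall>r c u.
        insert p K \<subseteq> cball 0 r \<longrightarrow>
        c \<in> carrier (relative_homology_group n (euclidean :: (real^'n) topology) (- cball 0 r)) \<longrightarrow>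
        u \<in> carrier (relative_homology_group n (top_of_set U) (U - K)) \<longrightarrow>
        hom_induced n (top_of_set U) (U - K) euclidean (- K) id u =
          hom_induced n euclidean (- cball 0 r) euclidean (- K) id c \<longrightarrow>
        hom_induced n (top_of_set U) (U - K) euclidean (- {p}) f u =
          hom_induced n euclidean (- cball 0 r) euclidean (- {p}) id c
            [^]\<^bsub>relative_homology_group n (euclidean :: (real^'n) topology) (- {p})\<^esub> d)"

(* The degree of phi on the frontier of U: the common value of the degree over all
   continuous extensions of phi to the closure of U. *)
definition boundary_degree ::
    "(real^'n \<Rightarrow> real^'n) \<Rightarrow> (real^'n) set \<Rightarrow> real^'n \<Rightarrow> int" where
  "boundary_degree \<phi> U p =
     (THE d. \<forall>\<psi>. continuous_on (closure U) \<psi> \<and> (\<forall>x\<in>frontier U. \<psi> x = \<phi> x) \<longrightarrow>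
        brouwer_degree \<psi> U p = d)"

end

theory Submission
  imports Defs
begin

text \<open>
  The set \<open>U\<close> is a thin tube \<open>{x. dist x (Im H) < \<epsilon>}\<close>. At a point \<open>x\<close> of its boundary with nearest
  curve point \<open>H s\<close>, the gradient is dominated by the nearby strand of the curve and its component
  along the normal \<open>\<nu> = x - H s\<close> is at least a fixed fraction of its norm. A continuous extension
  \<open>g\<close> of the tangent field is nowhere zero on the tube and almost orthogonal to \<open>\<nu>\<close>, so the gradient
  and \<open>g\<close> are joined on the boundary by a linear homotopy without zeros. A field homotopic on the
  boundary to one without zeros has degree \<open>0\<close>.
\<close>

subsection \<open>Degree of a field that is homotopic on the frontier to a nonvanishing one\<close>

text \<open>The angle constant of \<open>force_estimate\<close> does not depend on the distance to
  the curve. This fixes the order of choices: the allowed deviation of \<open>g\<close> from the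
  tangent is taken from that constant and the minimal speed, and only then is the tube made so thin
  that uniform continuity of \<open>g\<close> meets it. The gradient is \<open>1 - q\<close> < 0
  times \<open>curve_force\<close>, so a zero of the linear homotopy would put \<open>g x\<close>
  and the force on a common ray, although only one of them is nearly normal-free. On the homological
  side both degrees are definite descriptions, so 0 has to be shown admissible and also the only
  admissible value. The second half needs a class of infinite order at the origin that lifts to the
  complement of a large ball, and an actual extension of the boundary field. The seam, where
  parameters 0 and 1 meet, must not be special: shifts k in {-1, 0, 1} unroll the circle, and Taylor
  bounds are proved across it.\<close>

lemma iso_obtain_preimage:
  assumes "h \<in> iso G H" "y \<in> carrier H"
  obtains x where "x \<in> carrier G" "h x = y"
  using assms unfolding iso_iff by (metis imageE)

lemma iso_eqD:
  assumes "h \<in> iso G H" "x \<in> carrier G" "y \<in> carrier G" "h x = h y"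
  shows "x = y"
  using assms unfolding iso_iff by (metis inj_onD)

text \<open>The homotopy inverse pushes every point radially outwards, adding R to its norm. The
  segment from \<open>g x\<close> back to x never gets closer to the origin than x, so the same
  linear homotopy works in both complements.\<close>

lemma inclusion_minus_cball_iso:
  fixes r R :: real
  assumes "0 \<le> r" "r \<le> R"
  shows "hom_induced p (top_of_set (- cball 0 R)) {} (top_of_set (- cball (0::'a::euclidean_space) r)) {} id
    \<in> iso (reduced_homology_group p (top_of_set (- cball 0 R)))
           (reduced_homology_group p (top_of_set (- cball 0 r)))"
proof -
  define g where "g x = (R / norm x + 1) *\<^sub>R x" for x :: 'a
  have ng: "norm (g x) = R + norm x" if "x \<noteq> 0" for x
    using that assms by (simp add: g_def field_simps)
  have cg: "continuous_on (- cball 0 r) g"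
    unfolding g_def using assms by (intro continuous_intros) auto
  have seg: "closed_segment (g x) x \<subseteq> - cball 0 t" if x: "x \<notin> cball 0 t" and "t \<ge> 0" for x t
  proof
    fix y assume "y \<in> closed_segment (g x) x"
    then obtain u where u: "0 \<le> u" "u \<le> 1" "y = (1 - u) *\<^sub>R g x + u *\<^sub>R x"
      by (auto simp: in_segment)
    have "y = (1 + (1 - u) * (R / norm x)) *\<^sub>R x"
      by (simp add: u g_def algebra_simps)
    moreover have "1 + (1 - u) * (R / norm x) \<ge> 1"
      using u assms by auto
    ultimately have "norm y \<ge> norm x"
      by (simp add: mult_le_cancel_right1)
    then show "y \<in> - cball 0 t"
      using x by auto
  qed
  have gin: "g x \<in> - cball 0 R" if "x \<in> - cball 0 r" for x
  proof -
    have "x \<noteq> 0" using that assms by auto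
    then show ?thesis using ng by auto
  qed
  have sub: "- cball 0 R \<subseteq> - cball (0::'a) r"
    using assms by auto
  show ?thesis
  proof (rule homotopy_equivalence_reduced_homology_group_isomorphism)
    show "continuous_map (top_of_set (- cball 0 R)) (top_of_set (- cball 0 r)) (id :: 'a \<Rightarrow> 'a)"
      using sub by auto
    show "continuous_map (top_of_set (- cball 0 r)) (top_of_set (- cball 0 R)) g"
      using cg gin by auto
    show "homotopic_with (\<lambda>h. True) (top_of_set (- cball 0 R)) (top_of_set (- cball 0 R)) (g \<circ> id) id"
      unfolding o_id using cg sub assms seg[of _ R]
      by (intro homotopic_with_linear) (auto intro: continuous_on_subset)
    show "homotopic_with (\<lambda>h. True) (top_of_set (- cball 0 r)) (top_of_set (- cball 0 r)) (id \<circ> g) id"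
      unfolding id_o using cg assms seg[of _ r]
      by (intro homotopic_with_linear) auto
  qed
qed

text \<open>Euclidean space is contractible, so boundary maps identify the relative groups with
  reduced homology of the complements; naturality then carries over the isomorphism above. It serves
  to enlarge the ball, and with r = 0 to start from the punctured space.\<close>

lemma relative_homology_minus_cball_lift:
  fixes r R :: real
  assumes "0 \<le> r" "r \<le> R"
    and c: "c \<in> carrier (relative_homology_group p (euclidean :: 'a::euclidean_space topology) (- cball 0 r))"
  obtains c' where "c' \<in> carrier (relative_homology_group p euclidean (- cball (0::'a) R))"
    and "hom_induced p euclidean (- cball 0 R) euclidean (- cball 0 r) id c' = c"
proof -
  have ne: "topspace euclidean \<inter> - cball (0::'a) t \<noteq> {}" for t
    using bounded_cball[of "0::'a" t] not_bounded_UNIV by (metis Compl_empty_eq compl_le_compl_iff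
      double_compl inf_top_left topspace_euclidean)
  have contr: "contractible_space (euclidean :: 'a topology)"
    using contractible_space_top_of_set[of "UNIV::'a set"] contractible_UNIV by simp
  let ?b = "\<lambda>t. hom_boundary p euclidean (- cball (0::'a) t)"
  let ?j = "hom_induced (p-1) (top_of_set (- cball 0 R)) {} (top_of_set (- cball (0::'a) r)) {} id"
  let ?i = "hom_induced p euclidean (- cball (0::'a) R) euclidean (- cball 0 r) id"
  have b: "?b t \<in> iso (relative_homology_group p euclidean (- cball 0 t))
        (reduced_homology_group (p-1) (top_of_set (- cball 0 t)))" for t
    by (rule iso_relative_homology_of_contractible[OF contr ne])
  have j: "?j \<in> iso (reduced_homology_group (p-1) (top_of_set (- cball 0 R)))
           (reduced_homology_group (p-1) (top_of_set (- cball 0 r)))"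
    by (rule inclusion_minus_cball_iso[OF assms(1,2)])
  have nat: "?b r \<circ> ?i = ?j \<circ> ?b R"
    using assms by (intro naturality_hom_induced) auto
  have "?b r c \<in> carrier (reduced_homology_group (p-1) (top_of_set (- cball 0 r)))"
    using b[of r] c by (auto simp: iso_iff)
  then obtain d where d: "d \<in> carrier (reduced_homology_group (p-1) (top_of_set (- cball 0 R)))" "?j d = ?b r c"
    by (rule iso_obtain_preimage[OF j])
  then obtain c' where c': "c' \<in> carrier (relative_homology_group p euclidean (- cball 0 R))" "?b R c' = d"
    by (metis iso_obtain_preimage[OF b[of R]])
  have "?b r (?i c') = ?b r c"
    using fun_cong[OF nat, of c'] c' d by simp
  then have "?i c' = c"
    by (rule iso_eqD[OF b[of r] hom_induced_carrier c])
  with c' show thesis by (intro that)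
qed

text \<open>The excised set is the closed set \<open>- U\<close>; it lies in \<open>- K\<close>,
  which is open by compactness.\<close>

lemma excision_compact_in_open:
  fixes U K :: "'a::t2_space set"
  assumes "open U" "compact K" "K \<subseteq> U"
  shows "hom_induced p (top_of_set U) (U - K) euclidean (- K) id
    \<in> iso (relative_homology_group p (top_of_set U) (U - K)) (relative_homology_group p euclidean (- K))"
proof -
  have "euclidean closure_of (- U) \<subseteq> euclidean interior_of (- K)"
  proof -
    have "closed (- U)" "open (- K)"
      using assms by (auto simp: compact_imp_closed)
    then have "closure (- U) = - U" "interior (- K) = - K"
      by (auto simp only: closure_closed interior_open)
    then show ?thesis using assms by auto
  qed
  from homology_excision_axiom[OF this, of UNIV p] show ?thesis
    by (simp add: Diff_eq Int_commute)
qed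

text \<open>Contractibility of the whole space and retraction to the unit sphere make the group
  infinite cyclic, and c is a generator. It is what makes the exponent in
  \<open>brouwer_degree\<close> unique.\<close>

lemma relative_homology_punctured_infinite_order:
  obtains c where
    "c \<in> carrier (relative_homology_group (int DIM('a)) (euclidean :: 'a::euclidean_space topology) (- {0}))"
    and "\<And>d::int. c [^]\<^bsub>relative_homology_group (int DIM('a)) (euclidean :: 'a topology) (- {0})\<^esub> d =
            \<one>\<^bsub>relative_homology_group (int DIM('a)) (euclidean :: 'a topology) (- {0})\<^esub> \<Longrightarrow> d = 0"
proof -
  let ?G = "relative_homology_group (int DIM('a)) (euclidean :: 'a topology) (- {0})"
  let ?n = "DIM('a) - 1"
  obtain f :: "(nat \<Rightarrow> real) \<Rightarrow> 'a" and g where "homeomorphic_maps (nsphere ?n) (top_of_set (sphere 0 1)) f g"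
    using homeomorphic_maps_nsphere_euclidean_sphere[OF independent_Basis orthogonal_Basis refl _ norm_Basis, where 'n='a]
    by auto
  then have hs: "nsphere ?n homotopy_equivalent_space top_of_set (sphere (0::'a) 1)"
    using homeomorphic_imp_homotopy_equivalent_space homeomorphic_space_def by blast
  have "top_of_set (- {0::'a}) homotopy_equivalent_space top_of_set (sphere (0::'a) 1)"
    unfolding homotopy_equivalent_space_def
  proof (intro exI conjI)
    show "continuous_map (top_of_set (- {0})) (top_of_set (sphere 0 1)) (\<lambda>x::'a. x /\<^sub>R norm x)"
      by (auto intro!: continuous_intros)
    show "continuous_map (top_of_set (sphere 0 1)) (top_of_set (- {0})) (id::'a\<Rightarrow>'a)"
      by auto
    have "closed_segment (x /\<^sub>R norm x) x \<subseteq> - {0}" if "x \<noteq> 0" for x :: 'a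
    proof
      fix y assume "y \<in> closed_segment (x /\<^sub>R norm x) x"
      then obtain u where u: "0 \<le> u" "u \<le> 1" "y = (1 - u) *\<^sub>R (x /\<^sub>R norm x) + u *\<^sub>R x"
        by (auto simp: in_segment)
      have "y = ((1 - u) * inverse (norm x) + u) *\<^sub>R x"
        by (simp add: u algebra_simps)
      moreover have "(1 - u) * inverse (norm x) + u > 0"
        using u that by (cases "u = 0") (auto intro!: add_nonneg_pos)
      ultimately show "y \<in> - {0}" using that by auto
    qed
    then show "homotopic_with (\<lambda>h. True) (top_of_set (- {0})) (top_of_set (- {0})) (id \<circ> (\<lambda>x::'a. x /\<^sub>R norm x)) id"
      unfolding id_o
      by (intro homotopic_with_linear) (auto intro!: continuous_intros)
    show "homotopic_with (\<lambda>h. True) (top_of_set (sphere 0 1)) (top_of_set (sphere 0 1)) ((\<lambda>x::'a. x /\<^sub>R norm x) \<circ> id) id"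
      by (rule homotopic_with_equal) (auto intro!: continuous_intros)
  qed
  then have "nsphere ?n homotopy_equivalent_space top_of_set (- {0::'a})"
    using hs by (metis homotopy_equivalent_space_sym homotopy_eqv_trans)
  then have 1: "reduced_homology_group (int ?n) (nsphere ?n) \<cong> reduced_homology_group (int ?n) (top_of_set (- {0::'a}))"
    by (rule homotopy_equivalent_space_imp_isomorphic_reduced_homology_groups)
  have contr: "contractible_space (euclidean :: 'a topology)"
    using contractible_space_top_of_set[of "UNIV::'a set"] contractible_UNIV by simp
  have "- {0::'a} \<noteq> {}"
    using nonempty_Basis nonzero_Basis by fastforce
  then have "?G \<cong> reduced_homology_group (int DIM('a) - 1) (top_of_set (- {0::'a}))"
    by (intro isomorphic_group_relative_homology_of_contractible[OF contr]) auto
  moreover have "int DIM('a) - 1 = int ?n"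
    using DIM_positive[where 'a='a] by linarith
  ultimately have "?G \<cong> integer_group"
    using 1 reduced_homology_group_nsphere(1)[of ?n]
    by (metis group.iso_sym group_reduced_homology_group iso_trans)
  then obtain h where h: "h \<in> iso ?G integer_group"
    by (auto simp: is_iso_def)
  obtain c where c: "c \<in> carrier ?G" "h c = 1"
    by (rule iso_obtain_preimage[OF h, of 1]) auto
  have hom: "group_hom ?G integer_group h"
    using h by (simp add: group_hom_def group_hom_axioms_def iso_imp_homomorphism)
  have "d = 0" if "c [^]\<^bsub>?G\<^esub> (d::int) = \<one>\<^bsub>?G\<^esub>" for d
  proof -
    have "h (c [^]\<^bsub>?G\<^esub> d) = h c [^]\<^bsub>integer_group\<^esub> d"
      using group_hom.hom_int_pow[OF hom] c by blast
    then show ?thesis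
      using that c group_hom.hom_one[OF hom] by simp
  qed
  with c show thesis by (intro that)
qed

section \<open>Zero sets of linear homotopies and vanishing of the degree\<close>

lemma compact_zeros_linear_homotopy:
  fixes f g :: "'a::euclidean_space \<Rightarrow> 'b::real_normed_vector"
  assumes "bounded U" "continuous_on (closure U) f" "continuous_on (closure U) g"
    and "\<And>x. x \<in> frontier U \<Longrightarrow> 0 \<notin> closed_segment (f x) (g x)"
  shows "compact {x \<in> U. 0 \<in> closed_segment (f x) (g x)}"
proof -
  let ?h = "\<lambda>z. (1 - fst z) *\<^sub>R f (snd z) + fst z *\<^sub>R g (snd z)"
  let ?Z = "{z \<in> {0..1::real} \<times> closure U. ?h z = 0}"
  have "continuous_on ({0..1} \<times> closure U) ?h"
    using assms by (intro continuous_intros continuous_on_compose2[of "closure U" _ _ snd]) auto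
  then have "closed ?Z"
    by (intro continuous_closed_preimage_constant) (auto intro: closed_Times)
  moreover have "compact ({0..1::real} \<times> closure U)"
    using assms by (intro compact_Times) (auto simp: compact_closure)
  ultimately have "compact (({0..1} \<times> closure U) \<inter> ?Z)"
    by (rule compact_Int_closed[rotated])
  moreover have "({0..1} \<times> closure U) \<inter> ?Z = ?Z"
    by blast
  ultimately have "compact ?Z"
    by (simp only:)
  then have "compact (snd ` ?Z)"
    by (intro compact_continuous_image continuous_intros)
  \<comment> \<open>Projecting the compact zero set in parameter and space forgets the parameter;
    the hypothesis on the frontier then pushes the projection from the closure into U.\<close>
  moreover have "snd ` ?Z = {x \<in> closure U. 0 \<in> closed_segment (f x) (g x)}"
    by (force simp: in_segment image_iff)
  moreover have "{x \<in> closure U. 0 \<in> closed_segment (f x) (g x)} = {x \<in> U. 0 \<in> closed_segment (f x) (g x)}"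
  proof -
    have "x \<in> U" if "x \<in> closure U" "0 \<in> closed_segment (f x) (g x)" for x
      using assms(4) that interior_subset unfolding frontier_def by blast
    then show ?thesis using closure_subset[of U] by auto
  qed
  ultimately show ?thesis by simp
qed

lemma compact_zeros:
  fixes f :: "'a::euclidean_space \<Rightarrow> 'b::real_normed_vector"
  assumes "bounded U" "continuous_on (closure U) f" "\<And>x. x \<in> frontier U \<Longrightarrow> f x \<noteq> 0"
  shows "compact {x \<in> U. f x = 0}"
proof -
  have "compact {x \<in> U. 0 \<in> closed_segment (f x) (f x)}"
    using assms(3) by (intro compact_zeros_linear_homotopy assms(1,2)) auto
  moreover have "{x \<in> U. 0 \<in> closed_segment (f x) (f x)} = {x \<in> U. f x = 0}"
    by auto
  ultimately show ?thesis
    by (simp only:)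
qed

text \<open>The induced map factors through the pair (T, T), whose relative homology is
  trivial.\<close>

lemma hom_induced_avoiding_trivial:
  fixes g :: "'a::topological_space \<Rightarrow> 'b::topological_space"
  assumes "continuous_on U g" "g ` U \<subseteq> T"
  shows "hom_induced p (top_of_set U) S euclidean T g u = \<one>\<^bsub>relative_homology_group p euclidean T\<^esub>"
proof -
  let ?G = "relative_homology_group p (top_of_set T) T"
  have triv: "trivial_group ?G"
    using trivial_relative_homology_group_topspace[of p "top_of_set T"] by simp
  \<comment> \<open>S may stick out of U; \<open>hom_induced\<close> sees only the part inside the
    space, and \<open>hom_induced_restrict\<close> restores S at the end.\<close>
  have "hom_induced p (top_of_set U) (U \<inter> S) euclidean T (id \<circ> g) u =
    hom_induced p (top_of_set T) T euclidean T id (hom_induced p (top_of_set U) (U \<inter> S) (top_of_set T) T g u)"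
    using assms by (intro hom_induced_compose'[symmetric]) auto
  also have "hom_induced p (top_of_set U) (U \<inter> S) (top_of_set T) T g u = \<one>\<^bsub>?G\<^esub>"
    using triv hom_induced_carrier by (metis singletonD trivial_group_def)
  also have "hom_induced p (top_of_set T) T euclidean T id (\<one>\<^bsub>?G\<^esub>) = \<one>\<^bsub>relative_homology_group p euclidean T\<^esub>"
    by (intro hom_one[OF hom_induced_hom]) auto
  finally show ?thesis
    using hom_induced_restrict[of p "top_of_set U" S euclidean T] by simp
qed

text \<open>
  The zero set \<open>K'\<close> of the whole homotopy is compact in \<open>U\<close>. Lifting \<open>c\<close> to the complement of a ball
  around \<open>K'\<close> and excising shows that \<open>u\<close> comes from \<open>(U, U - K')\<close>, where \<open>\<psi>\<close> and \<open>g\<close> induce the same map.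
\<close>

lemma hom_induced_nullhomotopic_boundary:
  fixes \<psi> g :: "'a::euclidean_space \<Rightarrow> 'b::real_normed_vector"
  assumes U: "open U" "bounded U"
    and cont: "continuous_on (closure U) \<psi>" "continuous_on (closure U) g"
    and g: "\<And>x. x \<in> U \<Longrightarrow> g x \<noteq> 0"
    and seg: "\<And>x. x \<in> frontier U \<Longrightarrow> 0 \<notin> closed_segment (\<psi> x) (g x)"
    and K: "K = {x \<in> U. \<psi> x = 0}" "K \<subseteq> cball 0 r" "0 \<le> r"
    and c: "c \<in> carrier (relative_homology_group p euclidean (- cball 0 r))"
    and u: "u \<in> carrier (relative_homology_group p (top_of_set U) (U - K))"
    and cu: "hom_induced p (top_of_set U) (U - K) euclidean (- K) id u =
          hom_induced p euclidean (- cball 0 r) euclidean (- K) id c"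
  shows "hom_induced p (top_of_set U) (U - K) euclidean (- {0}) \<psi> u =
    \<one>\<^bsub>relative_homology_group p (euclidean :: 'b topology) (- {0})\<^esub>"
proof -
  define K' where "K' = {x \<in> U. 0 \<in> closed_segment (\<psi> x) (g x)}"
  have cK': "compact K'"
    unfolding K'_def using compact_zeros_linear_homotopy[OF U(2) cont seg] .
  have K'U: "K' \<subseteq> U" and KK': "K \<subseteq> K'" and KU: "K \<subseteq> U"
    by (auto simp: K'_def K)
  have contU: "continuous_on U \<psi>" "continuous_on U g"
    using cont closure_subset continuous_on_subset by blast+
  have "\<psi> x \<noteq> 0" if "x \<in> frontier U" for x
    using seg[OF that] ends_in_segment(1) by metis
  then have cK: "compact K"
    unfolding K(1) by (rule compact_zeros[OF U(2) cont(1)])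
  obtain b where b: "K' \<subseteq> cball 0 b"
    using compact_imp_bounded[OF cK'] unfolding bounded_iff subset_iff mem_cball_0 by blast
  define R where "R = max r b"
  have R: "K' \<subseteq> cball 0 R" "r \<le> R" "cball 0 r \<subseteq> cball (0::'a) R"
    using b by (auto simp: R_def)
  obtain c' where c': "c' \<in> carrier (relative_homology_group p euclidean (- cball 0 R))"
    and cc': "hom_induced p euclidean (- cball 0 R) euclidean (- cball 0 r) id c' = c"
    using relative_homology_minus_cball_lift[OF K(3) R(2) c] by blast
  obtain u' where u': "u' \<in> carrier (relative_homology_group p (top_of_set U) (U - K'))"
    and uc': "hom_induced p (top_of_set U) (U - K') euclidean (- K') id u' =
          hom_induced p euclidean (- cball 0 R) euclidean (- K') id c'"
    using iso_obtain_preimage[OF excision_compact_in_open[OF U(1) cK' K'U] hom_induced_carrier] by blast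
  \<comment> \<open>To see that \<open>?v\<close> is u, both are compared in the pair of the whole
    space and \<open>- K\<close>, where they have the same image and excision is injective.\<close>
  let ?v = "hom_induced p (top_of_set U) (U - K') (top_of_set U) (U - K) id u'"
  have "hom_induced p (top_of_set U) (U - K) euclidean (- K) id ?v =
      hom_induced p (top_of_set U) (U - K') euclidean (- K) (id \<circ> id) u'"
    using KK' by (intro hom_induced_compose') auto
  also have "\<dots> = hom_induced p euclidean (- K') euclidean (- K) id (hom_induced p (top_of_set U) (U - K') euclidean (- K') id u')"
    using KK' by (intro hom_induced_compose'[symmetric]) auto
  also have "\<dots> = hom_induced p euclidean (- cball 0 R) euclidean (- K) (id \<circ> id) c'"
    unfolding uc' using KK' R by (intro hom_induced_compose') auto
  also have "\<dots> = hom_induced p euclidean (- cball 0 r) euclidean (- K) id (hom_induced p euclidean (- cball 0 R) euclidean (- cball 0 r) id c')"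
    using K R by (intro hom_induced_compose'[symmetric]) auto
  also have "\<dots> = hom_induced p (top_of_set U) (U - K) euclidean (- K) id u"
    by (simp add: cc' cu)
  finally have v: "?v = u"
    using iso_eqD[OF excision_compact_in_open[OF U(1) cK KU] hom_induced_carrier u] by blast
  \<comment> \<open>Off \<open>K'\<close> the linear homotopy has no zeros, so it is a homotopy of
    maps of pairs; \<open>g\<close> then induces the trivial map, as it avoids 0 on all of
    U.\<close>
  have hom: "homotopic_with (\<lambda>h. h \<in> (U - K') \<rightarrow> - {0}) (top_of_set U) euclidean \<psi> g"
  proof -
    let ?h = "\<lambda>z. (1 - fst z) *\<^sub>R \<psi> (snd z) + fst z *\<^sub>R g (snd z)"
    have "continuous_on ({0..1} \<times> U) ?h"
      using contU by (intro continuous_intros continuous_on_compose2[of U _ _ snd]) auto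
    moreover have "(1 - t) *\<^sub>R \<psi> x + t *\<^sub>R g x \<noteq> 0" if "t \<in> {0..1}" "x \<in> U - K'" for t x
      using that by (auto simp: K'_def in_segment)
    ultimately show ?thesis
      unfolding homotopic_with_def
      by (intro exI[of _ ?h]) auto
  qed
  have "hom_induced p (top_of_set U) (U - K) euclidean (- {0}) \<psi> u =
      hom_induced p (top_of_set U) (U - K') euclidean (- {0}) (\<psi> \<circ> id) u'"
    unfolding v[symmetric] using KK' contU
    by (intro hom_induced_compose') (auto simp: K)
  also have "\<dots> = hom_induced p (top_of_set U) (U - K') euclidean (- {0}) g u'"
    using homology_homotopy_axiom[OF hom] by simp
  also have "\<dots> = \<one>\<^bsub>relative_homology_group p (euclidean :: 'b topology) (- {0})\<^esub>"
    using contU g by (intro hom_induced_avoiding_trivial) auto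
  finally show ?thesis .
qed

lemma brouwer_degree_eq_0:
  fixes \<psi> g :: "real^'n \<Rightarrow> real^'n"
  assumes U: "open U" "bounded U"
    and cont: "continuous_on (closure U) \<psi>" "continuous_on (closure U) g"
    and g: "\<And>x. x \<in> U \<Longrightarrow> g x \<noteq> 0"
    and seg: "\<And>x. x \<in> frontier U \<Longrightarrow> 0 \<notin> closed_segment (\<psi> x) (g x)"
  shows "brouwer_degree \<psi> U 0 = 0"
proof -
  define n where "n = int CARD('n)"
  define K where "K = {x \<in> U. \<psi> x = 0}"
  let ?G = "relative_homology_group n (euclidean :: (real^'n) topology) (- {0})"
  show ?thesis
    unfolding brouwer_degree_def Let_def n_def[symmetric] K_def[symmetric]
  proof (rule the_equality, intro allI impI)
    fix r c u
    assume r: "insert 0 K \<subseteq> cball 0 r"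
      and c: "c \<in> carrier (relative_homology_group n euclidean (- cball 0 r))"
      and u: "u \<in> carrier (relative_homology_group n (top_of_set U) (U - K))"
        "hom_induced n (top_of_set U) (U - K) euclidean (- K) id u =
          hom_induced n euclidean (- cball 0 r) euclidean (- K) id c"
    show "hom_induced n (top_of_set U) (U - K) euclidean (- {0}) \<psi> u =
      hom_induced n euclidean (- cball 0 r) euclidean (- {0}) id c [^]\<^bsub>?G\<^esub> (0::int)"
      using hom_induced_nullhomotopic_boundary[OF U cont g seg K_def _ _ c u] r
      by (simp add: int_pow_0)
  next
    fix d :: int
    assume d: "\<forall>r c u. insert 0 K \<subseteq> cball 0 r \<longrightarrow>
        c \<in> carrier (relative_homology_group n euclidean (- cball 0 r)) \<longrightarrow>
        u \<in> carrier (relative_homology_group n (top_of_set U) (U - K)) \<longrightarrow>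
        hom_induced n (top_of_set U) (U - K) euclidean (- K) id u =
          hom_induced n euclidean (- cball 0 r) euclidean (- K) id c \<longrightarrow>
        hom_induced n (top_of_set U) (U - K) euclidean (- {0}) \<psi> u =
          hom_induced n euclidean (- cball 0 r) euclidean (- {0}) id c [^]\<^bsub>?G\<^esub> d"
    have KU: "K \<subseteq> U" by (auto simp: K_def)
    have "\<psi> x \<noteq> 0" if "x \<in> frontier U" for x
      using seg[OF that] ends_in_segment(1) by metis
    then have cK: "compact K"
      unfolding K_def by (rule compact_zeros[OF U(2) cont(1)])
    \<comment> \<open>Uniqueness of the exponent: the description is tested on a class c whose image
      \<open>c0\<close> at the origin has infinite order, with u supplied by excision.\<close>
    obtain c0 where c0: "c0 \<in> carrier ?G"
      and inf: "\<And>d::int. c0 [^]\<^bsub>?G\<^esub> d = \<one>\<^bsub>?G\<^esub> \<Longrightarrow> d = 0"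
      using relative_homology_punctured_infinite_order[where 'a="real^'n"] unfolding n_def by auto
    obtain r0 where r0: "K \<subseteq> cball 0 r0"
      using compact_imp_bounded[OF cK] unfolding bounded_iff subset_iff mem_cball_0 by blast
    define r where "r = max 0 r0"
    have r: "insert 0 K \<subseteq> cball 0 r" "0 \<le> r" "K \<subseteq> cball 0 r"
      using r0 by (auto simp: r_def)
    \<comment> \<open>The punctured space is the complement of the ball of radius 0, so the lifting
      lemma applies to \<open>c0\<close>.\<close>
    have c0': "c0 \<in> carrier (relative_homology_group n euclidean (- cball 0 0))"
      using c0 by (simp only: cball_trivial)
    obtain c where c: "c \<in> carrier (relative_homology_group n euclidean (- cball 0 r))"
      and cc0: "hom_induced n euclidean (- cball 0 r) euclidean (- {0}) id c = c0"
      using relative_homology_minus_cball_lift[OF order_refl r(2) c0'] unfolding cball_trivial .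
    obtain u where u: "u \<in> carrier (relative_homology_group n (top_of_set U) (U - K))"
        "hom_induced n (top_of_set U) (U - K) euclidean (- K) id u =
          hom_induced n euclidean (- cball 0 r) euclidean (- K) id c"
      using iso_obtain_preimage[OF excision_compact_in_open[OF U(1) cK KU] hom_induced_carrier] by blast
    have "c0 [^]\<^bsub>?G\<^esub> d = \<one>\<^bsub>?G\<^esub>"
      using d[rule_format, OF r(1) c u] hom_induced_nullhomotopic_boundary[OF U cont g seg K_def r(3,2) c u] cc0
      by simp
    then show "d = 0" by (rule inf)
  qed
qed

lemma boundary_degree_eq_0:
  fixes \<phi> g :: "real^'n \<Rightarrow> real^'n"
  assumes U: "open U" "bounded U"
    and \<phi>: "continuous_on (frontier U) \<phi>"
    and g: "continuous_on (closure U) g" "\<And>x. x \<in> U \<Longrightarrow> g x \<noteq> 0"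
    and seg: "\<And>x. x \<in> frontier U \<Longrightarrow> 0 \<notin> closed_segment (\<phi> x) (g x)"
  shows "boundary_degree \<phi> U 0 = 0"
proof -
  have zero: "brouwer_degree \<psi> U 0 = 0"
    if "continuous_on (closure U) \<psi> \<and> (\<forall>x\<in>frontier U. \<psi> x = \<phi> x)" for \<psi>
    using that U g seg by (intro brouwer_degree_eq_0[where g=g]) auto
  \<comment> \<open>Without an extension every integer would satisfy the description in
    \<open>boundary_degree\<close>; Tietze supplies one.\<close>
  have "closedin (top_of_set (closure U)) (frontier U)"
    by (metis closed_subset frontier_closed frontier_def Diff_subset)
  then obtain \<psi> where "continuous_on (closure U) \<psi>" "\<And>x. x \<in> frontier U \<Longrightarrow> \<psi> x = \<phi> x"
    using Tietze_unbounded[OF \<phi>] by blast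
  then have "d = 0" if "\<forall>\<psi>. continuous_on (closure U) \<psi> \<and> (\<forall>x\<in>frontier U. \<psi> x = \<phi> x) \<longrightarrow>
      brouwer_degree \<psi> U 0 = d" for d
    using that zero by metis
  with zero show ?thesis
    unfolding boundary_degree_def by (intro the_equality allI impI)
qed

subsection \<open>The gradient of the potential\<close>

lemma has_derivative_norm_powr:
  fixes a x :: "'a::real_inner"
  assumes "x \<noteq> a"
  shows "((\<lambda>x. norm (x - a) powr p) has_derivative
    (\<bullet>) ((p * norm (x - a) powr (p - 2)) *\<^sub>R (x - a))) (at x within S)"
proof -
  have "GDERIV norm (x - a) :> sgn (x - a)"
    using assms by (intro GDERIV_norm) auto
  then have "(norm has_derivative (\<lambda>h. h \<bullet> sgn (x - a))) (at (x - a))"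
    by (simp add: gderiv_def)
  moreover have "((\<lambda>x. x - a) has_derivative (\<lambda>h. h)) (at x)"
    by (auto intro!: derivative_eq_intros)
  ultimately have n: "((\<lambda>x. norm (x - a)) has_derivative (\<lambda>h. h \<bullet> sgn (x - a))) (at x)"
    by (rule has_derivative_compose[rotated])
  have "((\<lambda>z. z powr p) has_derivative (\<lambda>h. (p * norm (x - a) powr (p - 1)) * h)) (at (norm (x - a)))"
    using has_real_derivative_powr[of "norm (x - a)" p] assms by (simp add: has_field_derivative_def)
  from has_derivative_compose[OF n this]
  have "((\<lambda>x. norm (x - a) powr p) has_derivative
      (\<lambda>h. (p * norm (x - a) powr (p - 1)) * (h \<bullet> sgn (x - a)))) (at x)" .
  moreover have "(p * norm (x - a) powr (p - 1)) * (h \<bullet> sgn (x - a)) =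
      ((p * norm (x - a) powr (p - 2)) *\<^sub>R (x - a)) \<bullet> h" for h
  proof -
    have "norm (x - a) powr (p - 1) = norm (x - a) powr (p - 2) * norm (x - a)"
      using assms by (simp add: powr_diff powr_numeral power2_eq_square field_simps)
    then show ?thesis
      using assms by (simp add: sgn_div_norm inner_commute)
  qed
  ultimately show ?thesis
    by (simp only: has_derivative_at_withinI)
qed

lemma gradient_eqI:
  assumes "GDERIV f x :> D"
  shows "gradient f x = D"
  unfolding gradient_def
proof (rule the_equality)
  show "E = D" if "GDERIV f x :> E" for E
  proof -
    have "(\<lambda>h. h \<bullet> E) = (\<lambda>h. h \<bullet> D)"
      using assms that has_derivative_unique unfolding gderiv_def by blast
    then have "(E - D) \<bullet> E = (E - D) \<bullet> D" by metis
    then have "(E - D) \<bullet> (E - D) = 0" by (simp add: inner_diff_right)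
    then show ?thesis by simp
  qed
qed (fact assms)

text \<open>The gradient of the potential without its negative factor \<open>1 - q\<close>, so that
  near the curve the field points away from it.\<close>

definition curve_force :: "real \<Rightarrow> (real \<Rightarrow> 'a::euclidean_space) \<Rightarrow> 'a \<Rightarrow> 'a" where
  "curve_force q H x = integral {0..1} (\<lambda>t. (norm (x - H t) powr (- q - 1)) *\<^sub>R (x - H t))"

lemma continuous_on_curve_force_integrand:
  fixes H :: "real \<Rightarrow> 'a::euclidean_space"
  assumes "continuous_on {0..1} H" "U \<inter> path_image H = {}"
  shows "continuous_on (U \<times> {0..1}) (\<lambda>(x, t). (norm (x - H t) powr p) *\<^sub>R (x - H t))"
  unfolding split_beta using assms
  by (intro continuous_intros continuous_on_compose2[OF assms(1)]) (auto simp: path_image_def)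

lemma continuous_on_curve_force:
  fixes H :: "real \<Rightarrow> 'a::euclidean_space"
  assumes "continuous_on {0..1} H"
  shows "continuous_on (- path_image H) (curve_force q H)"
  unfolding curve_force_def cbox_interval[symmetric]
  by (rule integral_continuous_on_param)
     (use continuous_on_curve_force_integrand[OF assms, of "- path_image H" "-q-1"] in simp)

lemma gradient_curve_potential:
  fixes H :: "real \<Rightarrow> 'a::euclidean_space"
  assumes H: "continuous_on {0..1} H" and x: "x \<notin> path_image H"
  shows "gradient (curve_potential q H) x = (1 - q) *\<^sub>R curve_force q H x"
proof (rule gradient_eqI)
  have "closed (path_image H)"
    using H by (simp add: closed_path_image path_def)
  then obtain e where e: "e > 0" "ball x e \<inter> path_image H = {}"
    using x by (metis Compl_iff disjoint_eq_subset_Compl open_Compl open_contains_ball)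
  define G where "G y t = (1 - q) *\<^sub>R (norm (y - H t) powr (- q - 1)) *\<^sub>R (y - H t)" for y t
  have off: "y \<noteq> H t" if "y \<in> ball x e" "t \<in> {0..1}" for y t
    using e that by (auto simp: path_image_def)
  have G: "continuous_on (ball x e \<times> {0..1}) (\<lambda>(y, t). G y t)"
    using continuous_on_scaleR[OF continuous_on_const continuous_on_curve_force_integrand[OF H e(2)]]
    by (simp add: G_def split_beta)
  have Gx: "continuous_on {0..1} (G x)"
  proof -
    have "continuous_on {0..1} (\<lambda>t. (\<lambda>(y, t). G y t) (x, t))"
      by (rule continuous_on_compose2[OF G]) (use e in \<open>auto intro!: continuous_intros\<close>)
    then show ?thesis by simp
  qed
  \<comment> \<open>Differentiation under the integral needs a convex domain and a derivative
    continuous as a bounded linear map: hence the ball off the curve and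
    \<open>blinfun_inner_right\<close>.\<close>
  have "((\<lambda>y. integral (cbox 0 1) (\<lambda>t. norm (y - H t) powr (1 - q))) has_derivative
      integral (cbox 0 1) (\<lambda>t. blinfun_inner_right (G x t))) (at x within ball x e)"
  proof (rule leibniz_rule)
    show "((\<lambda>y. norm (y - H t) powr (1 - q)) has_derivative blinfun_inner_right (G y t)) (at y within ball x e)"
      if "y \<in> ball x e" "t \<in> cbox 0 1" for y t
    proof -
      have "((1 - q) * norm (y - H t) powr (1 - q - 2)) *\<^sub>R (y - H t) = G y t"
        by (simp add: G_def minus_diff_commute)
      moreover have "((\<lambda>y. norm (y - H t) powr (1 - q)) has_derivative
          (\<bullet>) (((1 - q) * norm (y - H t) powr (1 - q - 2)) *\<^sub>R (y - H t))) (at y within ball x e)"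
        by (rule has_derivative_norm_powr) (use off that in auto)
      ultimately have "((\<lambda>y. norm (y - H t) powr (1 - q)) has_derivative (\<bullet>) (G y t)) (at y within ball x e)"
        by (simp only:)
      then show ?thesis by simp
    qed
    show "(\<lambda>t. norm (y - H t) powr (1 - q)) integrable_on cbox 0 1" if "y \<in> ball x e" for y
      using off that by (intro integrable_continuous continuous_intros) (auto intro: H)
    show "continuous_on (ball x e \<times> cbox 0 1) (\<lambda>(x, t). blinfun_inner_right (G x t))"
      using bounded_linear.continuous_on[OF bounded_linear_blinfun_inner_right G] by (simp add: split_beta)
  qed (use e in auto)
  moreover have "at x within ball x e = at x"
    using e by (intro at_within_open) auto
  ultimately have "((\<lambda>y. integral (cbox 0 1) (\<lambda>t. norm (y - H t) powr (1 - q))) has_derivative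
      integral (cbox 0 1) (\<lambda>t. blinfun_inner_right (G x t))) (at x)"
    by (simp only:)
  moreover have "integral (cbox 0 1) (\<lambda>t. blinfun_inner_right (G x t)) = blinfun_inner_right (integral {0..1} (G x))"
    using integral_linear[OF integrable_continuous_real[OF Gx] bounded_linear_blinfun_inner_right] by (simp add: o_def)
  moreover have "integral {0..1} (G x) = (1 - q) *\<^sub>R curve_force q H x"
    by (simp only: curve_force_def integral_cmul[symmetric] G_def[abs_def])
  moreover have "curve_potential q H = (\<lambda>y. integral (cbox 0 1) (\<lambda>t. norm (y - H t) powr (1 - q)))"
    by (simp add: curve_potential_def fun_eq_iff powr_minus_divide[symmetric])
  moreover have "blinfun_apply (blinfun_inner_right v) = (\<lambda>h. h \<bullet> v)" for v :: 'a
    by (simp add: fun_eq_iff inner_commute)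
  ultimately show "GDERIV (curve_potential q H) x :> (1 - q) *\<^sub>R curve_force q H x"
    unfolding gderiv_def by (simp only:)
qed

subsection \<open>Regular closed curves\<close>

text \<open>For parameters in [0,1] this is the distance on the circle of length 1.\<close>

definition cyc_dist :: "real \<Rightarrow> real \<Rightarrow> real" where
  "cyc_dist s t = min \<bar>t - s\<bar> (1 - \<bar>t - s\<bar>)"

lemma cyc_dist_bounds:
  assumes "s \<in> {0..1}" "t \<in> {0..1}"
  shows "0 \<le> cyc_dist s t" "cyc_dist s t \<le> 1"
  using assms by (auto simp: cyc_dist_def)

text \<open>Taylor expansion needs a signed displacement; the integer k unrolls the circle so that
  this displacement is a shortest one.\<close>

lemma cyc_dist_obtain_shift:
  assumes "s \<in> {0..1}" "t \<in> {0..1}"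
  obtains k where "k \<in> {-1,0,1}" "\<bar>t - s + k\<bar> = cyc_dist s t"
proof -
  consider "cyc_dist s t = \<bar>t - s + 0\<bar>" | "cyc_dist s t = \<bar>t - s + (- 1)\<bar>" | "cyc_dist s t = \<bar>t - s + 1\<bar>"
    using assms by (fastforce simp: cyc_dist_def min_def abs_if split: if_splits)
  then show thesis
    by cases (metis that insertI1 insertI2)+
qed

text \<open>A continuous map from a compact space to a Hausdorff space is closed, hence a quotient
  map onto its image. It turns the tangent, a function of the parameter, into a function of the
  curve point.\<close>

lemma continuous_on_factor_compact:
  fixes f :: "'a::t2_space \<Rightarrow> 'b::t2_space" and h :: "'a \<Rightarrow> 'c::topological_space"
  assumes "compact S" "continuous_on S f" "continuous_on S h"
    and "\<And>x y. x \<in> S \<Longrightarrow> y \<in> S \<Longrightarrow> f x = f y \<Longrightarrow> h x = h y"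
  obtains g where "continuous_on (f ` S) g" "\<And>x. x \<in> S \<Longrightarrow> g (f x) = h x"
proof
  define g where "g = h \<circ> inv_into S f"
  show gf: "g (f x) = h x" if "x \<in> S" for x
    using assms(4) that by (metis comp_apply f_inv_into_f g_def imageI inv_into_into)
  show "continuous_on (f ` S) g"
    unfolding continuous_closedin_preimage_eq
  proof (intro allI impI)
    fix C :: "'c set" assume "closed C"
    then have "compact (S \<inter> h -` C)"
      using assms continuous_closedin_preimage_eq closedin_compact by blast
    then have "compact (f ` (S \<inter> h -` C))"
      using assms by (metis compact_continuous_image continuous_on_subset inf_le1)
    moreover have "f ` S \<inter> g -` C = f ` (S \<inter> h -` C)"
      using gf by auto
    ultimately show "closedin (top_of_set (f ` S)) (f ` S \<inter> g -` C)"
      by (metis closed_subset compact_imp_closed inf_le1)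
  qed
qed

text \<open>The total variation of arctan is pi, so the bound is uniform in \<rho> and a; this
  uniformity is the point.\<close>

lemma integral_arctan_kernel_le:
  fixes \<rho> k a :: real
  assumes "\<rho> > 0" "k > 0"
  shows "(\<lambda>t. \<rho> / (\<rho>\<^sup>2 + k\<^sup>2 * (t - a)\<^sup>2)) integrable_on {0..1}"
    and "integral {0..1} (\<lambda>t. \<rho> / (\<rho>\<^sup>2 + k\<^sup>2 * (t - a)\<^sup>2)) \<le> pi / k"
proof -
  define A where "A t = arctan (k * (t - a) / \<rho>) / k" for t
  have "(A has_vector_derivative \<rho> / (\<rho>\<^sup>2 + k\<^sup>2 * (t - a)\<^sup>2)) (at t within {0..1})" for t
  proof -
    have "(A has_real_derivative (inverse (1 + (k * (t - a) / \<rho>)\<^sup>2) * (k / \<rho>)) / k) (at t)"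
      unfolding A_def by (auto intro!: derivative_eq_intros simp: assms) (use assms in \<open>simp add: field_simps\<close>)
    moreover have "(inverse (1 + (k * (t - a) / \<rho>)\<^sup>2) * (k / \<rho>)) / k = \<rho> / (\<rho>\<^sup>2 + k\<^sup>2 * (t - a)\<^sup>2)"
    proof -
      have "1 + (k * (t - a) / \<rho>)\<^sup>2 = (\<rho>\<^sup>2 + k\<^sup>2 * (t - a)\<^sup>2) / \<rho>\<^sup>2"
        using assms by (simp add: field_simps power2_eq_square)
      then show ?thesis
        using assms by (simp add: power2_eq_square)
    qed
    ultimately show ?thesis
      by (simp add: has_real_derivative_iff_has_vector_derivative has_vector_derivative_at_within)
  qed
  then have "((\<lambda>t. \<rho> / (\<rho>\<^sup>2 + k\<^sup>2 * (t - a)\<^sup>2)) has_integral (A 1 - A 0)) {0..1}"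
    by (intro fundamental_theorem_of_calculus) auto
  moreover have "A 1 - A 0 \<le> pi / k"
  proof -
    have "arctan x - arctan y \<le> pi" for x y :: real
      using arctan_ubound[of x] arctan_lbound[of y] by linarith
    then show ?thesis
      using assms by (simp add: A_def divide_right_mono flip: diff_divide_distrib)
  qed
  ultimately show "(\<lambda>t. \<rho> / (\<rho>\<^sup>2 + k\<^sup>2 * (t - a)\<^sup>2)) integrable_on {0..1}"
    "integral {0..1} (\<lambda>t. \<rho> / (\<rho>\<^sup>2 + k\<^sup>2 * (t - a)\<^sup>2)) \<le> pi / k"
    by (auto simp: has_integral_integrable integral_unique)
qed

section \<open>Elementary real inequalities\<close>

lemma power2_le_abs:
  fixes x :: real
  assumes "\<bar>x\<bar> \<le> 1"
  shows "x\<^sup>2 \<le> \<bar>x\<bar>"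
  using mult_left_le[of "\<bar>x\<bar>" "\<bar>x\<bar>"] assms by (simp add: power2_eq_square)

text \<open>For D up to \<beta> the first term suffices, beyond it the second. A small \<beta> makes
  the singular term cheap at the price of a large constant, which a factor \<rho> later
  absorbs.\<close>

lemma inverse_le_weighted:
  fixes D \<beta> :: real
  assumes "0 < D" "0 < \<beta>"
  shows "1 / D \<le> \<beta> / D\<^sup>2 + 1 / \<beta>"
proof (cases "D \<le> \<beta>")
  case True
  then have "1 / D \<le> \<beta> / D\<^sup>2"
    using assms by (simp add: field_simps power2_eq_square)
  with assms show ?thesis by (simp add: add_increasing2)
next
  case False
  then have "1 / D \<le> 1 / \<beta>"
    using assms by (simp add: frac_le)
  with assms show ?thesis by (simp add: add_increasing)
qed

lemma powr_le_of_ge: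
  fixes D \<rho> q :: real
  assumes "0 < \<rho>" "\<rho> \<le> D" "2 \<le> q"
  shows "D powr (- q) \<le> \<rho> powr (2 - q) / D\<^sup>2"
    and "D\<^sup>2 * D powr (- q - 1) \<le> \<rho> powr (2 - q) / D"
proof -
  have D: "0 < D" using assms by simp
  have le: "D powr (2 - q) \<le> \<rho> powr (2 - q)"
    using assms by (intro powr_mono2') auto
  have 1: "D powr (- q) = D powr (2 - q) / D\<^sup>2"
    using D by (simp add: powr_minus_divide powr_diff powr_numeral)
  have 2: "D\<^sup>2 * D powr (- q - 1) = D powr (2 - q) / D"
    using D by (simp add: powr_minus_divide powr_diff powr_numeral)
  show "D powr (- q) \<le> \<rho> powr (2 - q) / D\<^sup>2" "D\<^sup>2 * D powr (- q - 1) \<le> \<rho> powr (2 - q) / D"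
    unfolding 1 2 using le D by (auto intro: divide_right_mono)
qed

text \<open>First-order optimality in algebraic form: the test value \<open>\<sigma> = a / N\<close>
  turns the bound into \<open>N \<le> C\<close> unless a vanishes, and N is taken above C and at
  least the modulus of a.\<close>

lemma eq_0_if_quadratic_bound:
  fixes a C :: real
  assumes "\<And>\<sigma>. \<bar>\<sigma>\<bar> \<le> 1 \<Longrightarrow> \<sigma> * a \<le> C * \<sigma>\<^sup>2" "0 \<le> C"
  shows "a = 0"
proof (rule ccontr)
  assume "a \<noteq> 0"
  define N where "N = C + 1 + \<bar>a\<bar>"
  have N: "N > 0" "C < N" "\<bar>a\<bar> \<le> N" using assms(2) by (auto simp: N_def)
  then have "(a / N) * a \<le> C * (a / N)\<^sup>2"
    by (intro assms(1)) (simp add: abs_divide)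
  then have "a\<^sup>2 * N \<le> C * a\<^sup>2"
    using N by (simp add: field_simps power2_eq_square)
  then have "N \<le> C"
    using \<open>a \<noteq> 0\<close> by (simp add: mult.commute)
  with N show False by simp
qed

text \<open>The second derivative is condensed into a Lipschitz constant M of \<open>H'\<close>,
  which controls every quadratic Taylor remainder.\<close>

locale regular_closed_curve =
  fixes H H' :: "real \<Rightarrow> 'a::euclidean_space" and M :: real
  assumes deriv: "\<And>t. t \<in> {0..1} \<Longrightarrow> (H has_vector_derivative H' t) (at t within {0..1})"
    and M_pos: "0 < M"
    and lipschitz: "\<And>s t. s \<in> {0..1} \<Longrightarrow> t \<in> {0..1} \<Longrightarrow> norm (H' t - H' s) \<le> M * \<bar>t - s\<bar>"
    and closed_H: "H 0 = H 1" and closed_H': "H' 0 = H' 1"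
    and loop_free: "loop_free H"
    and regular: "\<And>t. t \<in> {0..1} \<Longrightarrow> H' t \<noteq> 0"
begin

section \<open>Taylor bounds, separation of strands and nearest points\<close>

lemma continuous_H: "continuous_on {0..1} H"
  using deriv by (meson continuous_on_eq_continuous_within has_vector_derivative_continuous)

lemma continuous_H': "continuous_on {0..1} H'"
proof -
  have "M-lipschitz_on {0..1} H'"
    using lipschitz M_pos by (intro lipschitz_onI) (auto simp: dist_norm norm_minus_commute abs_minus_commute)
  then show ?thesis by (rule lipschitz_on_continuous_on)
qed

lemma taylor:
  assumes "s \<in> {0..1}" "t \<in> {0..1}"
  shows "norm (H t - H s - (t - s) *\<^sub>R H' s) \<le> M * (t - s)\<^sup>2"
proof -
  let ?S = "closed_segment s t"
  have S: "?S \<subseteq> {0..1}"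
    using assms by (auto simp: closed_segment_eq_real_ivl split: if_splits)
  have "norm (H t - H s - (t - s) *\<^sub>R H' s) \<le> norm (t - s) * (M * \<bar>t - s\<bar>)"
  proof (rule vector_differentiable_bound_linearization[where S = ?S])
    show "(H has_vector_derivative H' x) (at x within ?S)" if "x \<in> ?S" for x
      using deriv S that by (meson has_vector_derivative_within_subset subsetD)
    show "norm (H' x - H' s) \<le> M * \<bar>t - s\<bar>" if "x \<in> ?S" for x
    proof -
      have "norm (H' x - H' s) \<le> M * \<bar>x - s\<bar>"
        using lipschitz assms S that by blast
      also have "\<bar>x - s\<bar> \<le> \<bar>t - s\<bar>"
        using that by (auto simp: closed_segment_eq_real_ivl split: if_splits)
      finally show ?thesis using M_pos by simp
    qed
  qed auto
  then show ?thesis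
    by (simp add: power2_eq_square abs_mult_self_eq mult_ac)
qed

text \<open>Across the seam the path from s to t splits into displacements \<alpha> and \<beta> of
  the same sign. Replacing \<open>H' s\<close> by the tangent at the seam costs M times their
  product, which fits into the cross term of \<open>(\<beta> + \<alpha>)\<^sup>2\<close>.\<close>

lemma taylor_cyclic:
  assumes s: "s \<in> {0..1}" and t: "t \<in> {0..1}" and k: "k \<in> {-1,0,1}"
  shows "norm (H t - H s - (t - s + k) *\<^sub>R H' s) \<le> M * (t - s + k)\<^sup>2"
proof -
  have *: "norm (H t - H s - (\<beta> + \<alpha>) *\<^sub>R H' s) \<le> M * (\<beta> + \<alpha>)\<^sup>2"
    if "norm (H t - H e - \<beta> *\<^sub>R H' e) \<le> M * \<beta>\<^sup>2" "norm (H e' - H s - \<alpha> *\<^sub>R H' s) \<le> M * \<alpha>\<^sup>2"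
      "norm (H' e' - H' s) \<le> M * \<bar>\<alpha>\<bar>" "0 \<le> \<alpha> * \<beta>" "H e' = H e" "H' e' = H' e" for \<alpha> \<beta> e e'
  proof -
    have "H t - H s - (\<beta> + \<alpha>) *\<^sub>R H' s =
        (H t - H e - \<beta> *\<^sub>R H' e) + (H e' - H s - \<alpha> *\<^sub>R H' s) + \<beta> *\<^sub>R (H' e' - H' s)"
      by (simp add: that(5,6) algebra_simps)
    also have "norm \<dots> \<le> M * \<beta>\<^sup>2 + M * \<alpha>\<^sup>2 + \<bar>\<beta>\<bar> * (M * \<bar>\<alpha>\<bar>)"
      using that by (intro norm_triangle_le add_mono) (auto intro!: mult_left_mono)
    also have "\<bar>\<beta>\<bar> * (M * \<bar>\<alpha>\<bar>) = M * (\<alpha> * \<beta>)"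
      using that(4) by (simp add: mult_ac flip: abs_mult)
    also have "M * \<beta>\<^sup>2 + M * \<alpha>\<^sup>2 + M * (\<alpha> * \<beta>) \<le> M * (\<beta> + \<alpha>)\<^sup>2"
    proof -
      have "M * (\<beta> + \<alpha>)\<^sup>2 = M * \<beta>\<^sup>2 + M * \<alpha>\<^sup>2 + M * (\<alpha> * \<beta>) + M * (\<alpha> * \<beta>)"
        by (simp add: power2_eq_square algebra_simps)
      then show ?thesis using M_pos that(4) by simp
    qed
    finally show ?thesis .
  qed
  consider "k = 0" | "k = -1" | "k = 1" using k by auto
  then show ?thesis
  proof cases
    case 1
    then show ?thesis using taylor s t by simp
  next
    case 2
    have "norm (H t - H s - ((t - 1) + (0 - s)) *\<^sub>R H' s) \<le> M * ((t - 1) + (0 - s))\<^sup>2"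
      using taylor[of 1 t] taylor[of s 0] lipschitz[of s 0] s t closed_H closed_H'
      by (intro *[of 1 _ 0]) (auto simp: mult_nonneg_nonpos)
    then show ?thesis using 2 by (simp add: algebra_simps)
  next
    case 3
    have "norm (H t - H s - ((t - 0) + (1 - s)) *\<^sub>R H' s) \<le> M * ((t - 0) + (1 - s))\<^sup>2"
      using taylor[of 0 t] taylor[of s 1] lipschitz[of s 1] s t closed_H closed_H'
      by (intro *[of 0 _ 1]) (auto simp: mult_nonneg_nonneg)
    then show ?thesis using 3 by (simp add: algebra_simps)
  qed
qed

lemma speed_bounds:
  obtains m L where "0 < m" "\<And>t. t \<in> {0..1} \<Longrightarrow> m \<le> norm (H' t)" "\<And>t. t \<in> {0..1} \<Longrightarrow> norm (H' t) \<le> L"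
proof -
  have "continuous_on {0..1} (\<lambda>t. norm (H' t))"
    using continuous_H' by (rule continuous_on_norm)
  then obtain a where a: "a \<in> {0..1}" "\<And>t. t \<in> {0..1} \<Longrightarrow> norm (H' a) \<le> norm (H' t)"
    using continuous_attains_inf[of "{0..1::real}" "\<lambda>t. norm (H' t)"] by auto
  obtain L where "\<And>t. t \<in> {0..1} \<Longrightarrow> norm (H' t) \<le> L"
    using compact_imp_bounded[OF compact_continuous_image[OF continuous_H' compact_Icc]]
    unfolding bounded_iff by blast
  with a show thesis
    by (intro that[of "norm (H' a)" L]) (auto simp: regular)
qed

lemma lipschitz_H:
  obtains L where "0 < L" "\<And>s t. s \<in> {0..1} \<Longrightarrow> t \<in> {0..1} \<Longrightarrow> norm (H t - H s) \<le> L * \<bar>t - s\<bar>"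
proof -
  obtain m L where L: "0 < m" "\<And>t. t \<in> {0..1} \<Longrightarrow> m \<le> norm (H' t)" "\<And>t. t \<in> {0..1} \<Longrightarrow> norm (H' t) \<le> L"
    using speed_bounds by metis
  have "norm (H t - H s) \<le> (L + M) * \<bar>t - s\<bar>" if s: "s \<in> {0..1}" and t: "t \<in> {0..1}" for s t
  proof -
    have "norm (H t - H s) \<le> norm ((t - s) *\<^sub>R H' s) + norm (H t - H s - (t - s) *\<^sub>R H' s)"
      by (metis norm_triangle_sub)
    also have "\<dots> \<le> L * \<bar>t - s\<bar> + M * (t - s)\<^sup>2"
      using taylor[OF s t] L(3)[OF s] by (intro add_mono) (auto simp: mult.commute intro!: mult_right_mono)
    also have "(t - s)\<^sup>2 \<le> \<bar>t - s\<bar>"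
      using s t by (intro power2_le_abs) auto
    finally show ?thesis using M_pos by (simp add: algebra_simps)
  qed
  moreover have "0 < L + M" using L(1) L(2,3)[of 0] M_pos by fastforce
  ultimately show thesis by (intro that)
qed

text \<open>Up to cyclic distance \<open>m / (2 * M)\<close> the Taylor remainder is at most half of
  the linear term; beyond it injectivity and compactness give a positive minimum.\<close>

lemma bi_lipschitz:
  obtains \<kappa> where "0 < \<kappa>" "\<And>s t. s \<in> {0..1} \<Longrightarrow> t \<in> {0..1} \<Longrightarrow> \<kappa> * cyc_dist s t \<le> norm (H t - H s)"
proof -
  obtain m where m: "0 < m" "\<And>t. t \<in> {0..1} \<Longrightarrow> m \<le> norm (H' t)"
    using speed_bounds by metis
  have near: "(m / 2) * cyc_dist s t \<le> norm (H t - H s)"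
    if s: "s \<in> {0..1}" and t: "t \<in> {0..1}" and d: "cyc_dist s t \<le> m / (2 * M)" for s t
  proof -
    obtain k where k: "k \<in> {-1,0,1}" "\<bar>t - s + k\<bar> = cyc_dist s t"
      using cyc_dist_obtain_shift[OF s t] .
    have "M * cyc_dist s t \<le> m / 2"
      using d M_pos by (simp add: field_simps)
    then have "M * (t - s + k)\<^sup>2 \<le> (m / 2) * cyc_dist s t"
      using mult_right_mono[of "M * cyc_dist s t" "m / 2" "cyc_dist s t"] cyc_dist_bounds[OF s t]
      by (subst power2_abs[symmetric]) (simp add: k power2_eq_square mult_ac)
    moreover have "m * cyc_dist s t \<le> norm ((t - s + k) *\<^sub>R H' s)"
      using m(2)[OF s] cyc_dist_bounds[OF s t] k(2) by (simp add: mult.commute[of m] mult_left_mono)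
    moreover have "norm ((t - s + k) *\<^sub>R H' s) \<le> norm (H t - H s) + norm (H t - H s - (t - s + k) *\<^sub>R H' s)"
      by (metis norm_minus_commute norm_triangle_sub)
    ultimately show ?thesis
      using taylor_cyclic[OF s t k(1)] by simp
  qed
  let ?P = "{z \<in> {0..1} \<times> {0..1}. m / (2 * M) \<le> cyc_dist (fst z) (snd z)}"
  have cont: "continuous_on ({0..1} \<times> {0..1}) (\<lambda>z. cyc_dist (fst z) (snd z))"
    unfolding cyc_dist_def by (intro continuous_intros)
  have "compact ?P"
  proof -
    have "closed ?P"
      using continuous_on_closed_Collect_le[OF continuous_on_const cont] by (auto intro: closed_Times)
    then have "compact (({0..1} \<times> {0..1}) \<inter> ?P)"
      by (intro compact_Int_closed compact_Times) auto
    moreover have "({0..1} \<times> {0..1}) \<inter> ?P = ?P" by blast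
    ultimately show ?thesis by (simp only:)
  qed
  have contH: "continuous_on ?P (\<lambda>z. norm (H (snd z) - H (fst z)))"
    by (intro continuous_intros continuous_on_compose2[OF continuous_H]) auto
  obtain \<mu> where \<mu>: "0 < \<mu>" "\<And>z. z \<in> ?P \<Longrightarrow> \<mu> \<le> norm (H (snd z) - H (fst z))"
  proof (cases "?P = {}")
    case True
    then show thesis by (intro that[of 1]) auto
  next
    case False
    then obtain z0 where z0: "z0 \<in> ?P" "\<And>z. z \<in> ?P \<Longrightarrow> norm (H (snd z0) - H (fst z0)) \<le> norm (H (snd z) - H (fst z))"
      using continuous_attains_inf[OF \<open>compact ?P\<close> _ contH] by blast
    have "0 < m / (2 * M)" using m M_pos by simp
    \<comment> \<open>Positive cyclic distance excludes both the diagonal and the seam pair of 0 and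
      1, the only coincidences that \<open>loop_free\<close> permits.\<close>
    then have "0 < cyc_dist (fst z0) (snd z0)" using z0(1) by auto
    then have "H (snd z0) \<noteq> H (fst z0)"
      using z0(1) loop_free unfolding loop_free_def cyc_dist_def by force
    then show thesis using z0 by (intro that[of "norm (H (snd z0) - H (fst z0))"]) auto
  qed
  define \<kappa> where "\<kappa> = min (m / 2) \<mu>"
  show thesis
  proof
    show "0 < \<kappa>" using m \<mu> by (simp add: \<kappa>_def)
    fix s t :: real assume s: "s \<in> {0..1}" and t: "t \<in> {0..1}"
    note c = cyc_dist_bounds[OF s t]
    show "\<kappa> * cyc_dist s t \<le> norm (H t - H s)"
    proof (cases "cyc_dist s t \<le> m / (2 * M)")
      case True
      have "\<kappa> * cyc_dist s t \<le> (m / 2) * cyc_dist s t"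
        using c by (intro mult_right_mono) (auto simp: \<kappa>_def)
      with near[OF s t True] show ?thesis by linarith
    next
      case False
      have "\<kappa> * cyc_dist s t \<le> \<mu> * 1"
        using c \<mu> m by (intro mult_mono) (auto simp: \<kappa>_def)
      also have "\<mu> \<le> norm (H t - H s)"
        using \<mu>(2)[of "(s, t)"] False s t by auto
      finally show ?thesis by simp
    qed
  qed
qed

text \<open>At s = 0 or s = 1 variations inside [0,1] are one-sided and would yield only an
  inequality. The variation \<sigma> therefore wraps around the seam, where
  \<open>taylor_cyclic\<close> still applies.\<close>

lemma nearest_point_orthogonal:
  assumes s: "s \<in> {0..1}" and near: "\<And>t. t \<in> {0..1} \<Longrightarrow> norm (x - H s) \<le> norm (x - H t)"
  shows "(x - H s) \<bullet> H' s = 0"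
proof (rule eq_0_if_quadratic_bound)
  define C where "C = (norm (H' s) + M)\<^sup>2 + 2 * (norm (x - H s) * M)"
  show "0 \<le> C / 2" using M_pos by (simp add: C_def)
  fix \<sigma> :: real assume \<sigma>: "\<bar>\<sigma>\<bar> \<le> 1"
  obtain t k where t: "t \<in> {0..1}" and k: "k \<in> {-1,0,1}" "\<sigma> = t - s + k"
  proof -
    consider "s + \<sigma> < 0" | "s + \<sigma> \<in> {0..1}" | "s + \<sigma> > 1" by fastforce
    then show thesis
    proof cases
      case 1 then show thesis using s \<sigma> by (intro that[of "s + \<sigma> + 1" "-1"]) auto
    next
      case 2 then show thesis using s \<sigma> by (intro that[of "s + \<sigma>" 0]) auto
    next
      case 3 then show thesis using s \<sigma> by (intro that[of "s + \<sigma> - 1" 1]) auto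
    qed
  qed
  define \<nu> where "\<nu> = x - H s"
  define \<Delta> where "\<Delta> = H t - H s"
  define e where "e = \<Delta> - \<sigma> *\<^sub>R H' s"
  have e: "norm e \<le> M * \<sigma>\<^sup>2"
    using taylor_cyclic[OF s t k(1)] by (simp add: e_def \<Delta>_def k(2))
  have \<sigma>2: "\<sigma>\<^sup>2 \<le> \<bar>\<sigma>\<bar>"
    by (rule power2_le_abs[OF \<sigma>])
  have "norm \<Delta> \<le> norm (\<sigma> *\<^sub>R H' s) + norm e"
    unfolding e_def by (metis norm_triangle_sub)
  also have "\<dots> \<le> \<bar>\<sigma>\<bar> * norm (H' s) + M * \<bar>\<sigma>\<bar>"
    using order_trans[OF e mult_left_mono[OF \<sigma>2, of M]] M_pos by simp
  finally have \<Delta>: "norm \<Delta> \<le> (norm (H' s) + M) * \<bar>\<sigma>\<bar>"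
    by (simp add: algebra_simps)
  have \<Delta>2: "(norm \<Delta>)\<^sup>2 \<le> (norm (H' s) + M)\<^sup>2 * \<sigma>\<^sup>2"
    using power_mono[OF \<Delta> norm_ge_zero, of 2] by (simp add: power_mult_distrib)
  have "(norm \<nu>)\<^sup>2 \<le> (norm (\<nu> - \<Delta>))\<^sup>2"
    using near[OF t] by (intro power_mono) (auto simp: \<nu>_def \<Delta>_def)
  then have "2 * (\<nu> \<bullet> \<Delta>) \<le> (norm \<Delta>)\<^sup>2"
    by (simp add: power2_norm_eq_inner inner_diff_left inner_diff_right inner_commute)
  moreover have "\<nu> \<bullet> \<Delta> = \<sigma> * (\<nu> \<bullet> H' s) + \<nu> \<bullet> e"
    by (simp add: e_def inner_diff_right)
  moreover have "- (\<nu> \<bullet> e) \<le> norm \<nu> * (M * \<sigma>\<^sup>2)"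
    using Cauchy_Schwarz_ineq2[of \<nu> e] mult_left_mono[OF e norm_ge_zero[of \<nu>]] by linarith
  ultimately have "2 * (\<sigma> * (\<nu> \<bullet> H' s)) \<le> C * \<sigma>\<^sup>2"
    using \<Delta>2 by (simp add: C_def \<nu>_def[symmetric] algebra_simps)
  then show "\<sigma> * ((x - H s) \<bullet> H' s) \<le> C / 2 * \<sigma>\<^sup>2"
    by (simp add: \<nu>_def)
qed

text \<open>
  With \<open>\<rho>\<close> the distance to the curve and \<open>D t = norm (x - H t)\<close>, the inner product is \<open>\<rho>\<^sup>2\<close> times the
  integral of \<open>D powr (- q - 1)\<close>, of order \<open>\<rho> powr (2 - q)\<close>, up to an error from the curvature of \<open>H\<close>. As
  \<open>D \<ge> \<rho>\<close> and \<open>q \<ge> 2\<close>, a factor \<open>\<rho> powr (2 - q)\<close> splits off from every other integral, which reduces them to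
  the integral of \<open>\<rho> / D\<^sup>2\<close>, bounded uniformly in \<open>x\<close> by comparison with the derivative of \<open>arctan\<close>. The
  error term \<open>\<rho> / D\<close>, logarithmic if \<open>q = 2\<close>, is split by a weight \<open>\<beta>\<close>.
\<close>

lemma force_estimate:
  assumes q: "2 \<le> q"
  obtains c r where "0 < c" "0 < r"
    "\<And>s x. s \<in> {0..1} \<Longrightarrow> x \<noteq> H s \<Longrightarrow> norm (x - H s) \<le> r \<Longrightarrow>
      (\<And>t. t \<in> {0..1} \<Longrightarrow> norm (x - H s) \<le> norm (x - H t)) \<Longrightarrow>
      curve_force q H x \<noteq> 0 \<and>
      c * norm (x - H s) * norm (curve_force q H x) \<le> curve_force q H x \<bullet> (x - H s)"
proof -
  obtain \<kappa>0 where \<kappa>0: "0 < \<kappa>0" "\<And>s t. s \<in> {0..1} \<Longrightarrow> t \<in> {0..1} \<Longrightarrow> \<kappa>0 * cyc_dist s t \<le> norm (H t - H s)"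
    using bi_lipschitz by blast
  obtain L where L: "0 < L" "\<And>s t. s \<in> {0..1} \<Longrightarrow> t \<in> {0..1} \<Longrightarrow> norm (H t - H s) \<le> L * \<bar>t - s\<bar>"
    using lipschitz_H by blast
  \<comment> \<open>Halving pays for moving from \<open>H s\<close> to x:
    \<open>\<kappa>0 * cyc_dist s t \<le> \<rho> + D t \<le> 2 * D t\<close>.\<close>
  define \<kappa> where "\<kappa> = \<kappa>0 / 2"
  define C where "C = M / \<kappa>\<^sup>2"
  \<comment> \<open>Three kernels, centred at s, s + 1 and s - 1, contribute
    \<open>2 * pi / \<kappa>\<close> each.\<close>
  define J0 where "J0 = 6 * pi / \<kappa>"
  define c0 where "c0 = (1 + L) powr (- q - 1)"
  \<comment> \<open>The main term is measured by \<open>c0\<close>. The choice of \<beta> keeps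
    \<open>C * \<beta> * J\<close> below a third of it, and that of r keeps
    \<open>C * \<rho> / \<beta>\<close> below another third. The last third, against the bound
    \<open>\<rho> powr (2 - q) / \<rho> * J0\<close> on the force, gives c. The cap 1/2 in r leaves
    room for an interval of length \<rho> next to s.\<close>
  define \<beta> where "\<beta> = c0 / (3 * C * J0)"
  define c where "c = c0 / (3 * J0)"
  define r where "r = min (1/2) (c0 * \<beta> / (3 * C))"
  have \<kappa>: "0 < \<kappa>" using \<kappa>0 by (simp add: \<kappa>_def)
  have C: "0 < C" using \<kappa> M_pos by (simp add: C_def)
  have J0: "0 < J0" using \<kappa> by (simp add: J0_def)
  have c0: "0 < c0" using L(1) by (simp add: c0_def)
  have \<beta>: "0 < \<beta>" using c0 C J0 by (simp add: \<beta>_def)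
  have c: "0 < c" using c0 J0 by (simp add: c_def)
  have r: "0 < r" using c0 \<beta> C by (simp add: r_def)
  show thesis
  proof (rule that[OF c r])
    fix s x
    assume s: "s \<in> {0..1}" and xs: "x \<noteq> H s" and rx: "norm (x - H s) \<le> r"
      and near: "\<And>t. t \<in> {0..1} \<Longrightarrow> norm (x - H s) \<le> norm (x - H t)"
    define \<nu> where "\<nu> = x - H s"
    define \<rho> where "\<rho> = norm \<nu>"
    define D where "D t = norm (x - H t)" for t
    have \<rho>: "0 < \<rho>" "\<rho> \<le> r" using xs rx by (auto simp: \<rho>_def \<nu>_def)
    have \<rho>D: "\<rho> \<le> D t" if "t \<in> {0..1}" for t
      using near[OF that] by (simp add: \<rho>_def \<nu>_def D_def)
    have Dpos: "0 < D t" if "t \<in> {0..1}" for t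
      using \<rho>D[OF that] \<rho> by linarith
    have D0: "\<forall>t\<in>{0..1}. D t \<noteq> 0"
      using Dpos by force
    have contD: "continuous_on {0..1} D"
      unfolding D_def by (intro continuous_intros continuous_H)
    have D\<kappa>: "\<kappa> * cyc_dist s t \<le> D t" if t: "t \<in> {0..1}" for t
    proof -
      have "\<kappa>0 * cyc_dist s t \<le> norm (H t - H s)" by (rule \<kappa>0(2)[OF s t])
      also have "norm (H t - H s) = norm (\<nu> - (x - H t))" by (simp add: \<nu>_def)
      also have "\<dots> \<le> \<rho> + D t" unfolding \<rho>_def D_def by (rule norm_triangle_ineq4)
      finally show ?thesis using \<rho>D[OF t] by (simp add: \<kappa>_def)
    qed
    \<comment> \<open>Orthogonality of the normal to \<open>H' s\<close> removes the linear Taylor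
      term, so only the quadratic remainder is lost; the cyclic distance bounds it by
      \<open>(D t)\<^sup>2\<close>.\<close>
    have num: "\<rho>\<^sup>2 - C * \<rho> * (D t)\<^sup>2 \<le> (x - H t) \<bullet> \<nu>" if t: "t \<in> {0..1}" for t
    proof -
      obtain k where k: "k \<in> {-1,0,1}" "\<bar>t - s + k\<bar> = cyc_dist s t"
        using cyc_dist_obtain_shift[OF s t] .
      define e where "e = H t - H s - (t - s + k) *\<^sub>R H' s"
      have "\<nu> \<bullet> H' s = 0"
        unfolding \<nu>_def by (rule nearest_point_orthogonal[OF s near])
      then have "(x - H t) \<bullet> \<nu> = \<rho>\<^sup>2 - \<nu> \<bullet> e"
        by (simp add: e_def \<rho>_def power2_norm_eq_inner inner_diff_left inner_diff_right \<nu>_def inner_commute)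
      moreover have "\<nu> \<bullet> e \<le> \<rho> * (M * (t - s + k)\<^sup>2)"
        using norm_cauchy_schwarz[of \<nu> e] mult_left_mono[OF taylor_cyclic[OF s t k(1)] norm_ge_zero[of \<nu>]]
        by (simp add: \<rho>_def e_def)
      moreover have "\<rho> * (M * (t - s + k)\<^sup>2) \<le> C * \<rho> * (D t)\<^sup>2"
      proof -
        have "(\<kappa> * cyc_dist s t)\<^sup>2 \<le> (D t)\<^sup>2"
          using D\<kappa>[OF t] \<kappa> cyc_dist_bounds[OF s t] by (intro power_mono) auto
        then have "(t - s + k)\<^sup>2 \<le> (D t)\<^sup>2 / \<kappa>\<^sup>2"
          using \<kappa> unfolding power2_abs[of "t - s + k", symmetric] k(2)
          by (simp add: power_mult_distrib pos_le_divide_eq mult.commute)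
        then have "\<rho> * M * (t - s + k)\<^sup>2 \<le> \<rho> * M * ((D t)\<^sup>2 / \<kappa>\<^sup>2)"
          using M_pos \<rho> by (intro mult_left_mono) auto
        then show ?thesis by (simp add: C_def mult_ac)
      qed
      ultimately show ?thesis by linarith
    qed
    have intD: "(\<lambda>t. D t powr p) integrable_on {0..1}" for p
      using D0 by (intro integrable_continuous_real continuous_intros contD) auto
    have intJ: "(\<lambda>t. \<rho> / (D t)\<^sup>2) integrable_on {0..1}"
      using D0 by (intro integrable_continuous_real continuous_intros contD) auto
    define J where "J = integral {0..1} (\<lambda>t. \<rho> / (D t)\<^sup>2)"
    have J: "J \<le> J0"
    proof -
      define K where "K a t = \<rho> / (\<rho>\<^sup>2 + \<kappa>\<^sup>2 * (t - a)\<^sup>2)" for a t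
      have K0: "0 \<le> K a t" for a t
        using \<rho> by (simp add: K_def)
      \<comment> \<open>\<open>D t\<close> dominates both \<rho> and
        \<open>\<kappa> * cyc_dist s t\<close>, hence twice its square dominates the sum of their
        squares. The shift k varies with t, so the kernels for all three shifts are added.\<close>
      have le: "\<rho> / (D t)\<^sup>2 \<le> 2 * K s t + 2 * K (s + 1) t + 2 * K (s - 1) t" if t: "t \<in> {0..1}" for t
      proof -
        obtain k where k: "k \<in> {-1,0,1}" "\<bar>t - s + k\<bar> = cyc_dist s t"
          using cyc_dist_obtain_shift[OF s t] .
        have "(\<kappa> * cyc_dist s t)\<^sup>2 \<le> (D t)\<^sup>2"
          using D\<kappa>[OF t] \<kappa> cyc_dist_bounds[OF s t] by (intro power_mono) auto
        moreover have "(cyc_dist s t)\<^sup>2 = (t - s + k)\<^sup>2"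
          by (simp flip: k(2))
        moreover have "\<rho>\<^sup>2 \<le> (D t)\<^sup>2"
          using \<rho>D[OF t] \<rho> by (intro power_mono) auto
        ultimately have "\<rho>\<^sup>2 + \<kappa>\<^sup>2 * (t - (s - k))\<^sup>2 \<le> 2 * (D t)\<^sup>2"
          by (simp add: power_mult_distrib algebra_simps)
        moreover have pos: "0 < \<rho>\<^sup>2 + \<kappa>\<^sup>2 * (t - (s - k))\<^sup>2"
          using \<rho> by (intro add_pos_nonneg) auto
        ultimately have "\<rho> / (2 * (D t)\<^sup>2) \<le> K (s - k) t"
          using \<rho> unfolding K_def by (intro divide_left_mono) (auto intro!: mult_pos_pos simp: Dpos[OF t] D0 t)
        then have "\<rho> / (D t)\<^sup>2 \<le> 2 * K (s - k) t"
          by simp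
        moreover have "k = 0 \<or> k = -1 \<or> k = 1" using k(1) by auto
        ultimately show ?thesis
          using K0[of s t] K0[of "s + 1" t] K0[of "s - 1" t] by (elim disjE) simp_all
      qed
      have I: "((\<lambda>t. 2 * K a t) integrable_on {0..1})" "integral {0..1} (\<lambda>t. 2 * K a t) \<le> 2 * (pi / \<kappa>)" for a
        using integral_arctan_kernel_le[OF \<rho>(1) \<kappa>, of a, folded K_def]
        by (auto intro: integrable_on_mult_right)
      have "J \<le> integral {0..1} (\<lambda>t. 2 * K s t + 2 * K (s + 1) t + 2 * K (s - 1) t)"
        unfolding J_def using le by (intro integral_le intJ integrable_add I)
      also have "\<dots> = integral {0..1} (\<lambda>t. 2 * K s t) + integral {0..1} (\<lambda>t. 2 * K (s + 1) t) + integral {0..1} (\<lambda>t. 2 * K (s - 1) t)"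
        by (simp only: integral_add integrable_add I(1))
      also have "\<dots> \<le> J0"
        using I(2)[of s] I(2)[of "s + 1"] I(2)[of "s - 1"] by (simp add: J0_def)
      finally show ?thesis .
    qed
    have lower: "c0 * \<rho> powr (- q) \<le> integral {0..1} (\<lambda>t. D t powr (- q - 1))"
    proof -
      have r2: "\<rho> \<le> 1 / 2" using \<rho> by (simp add: r_def)
      \<comment> \<open>The interval begins or ends at s, whichever side has room; on it
        \<open>D t\<close> is at most \<open>(1 + L) * \<rho>\<close>.\<close>
      obtain a where a: "0 \<le> a" "a + \<rho> \<le> 1" "\<And>t. t \<in> {a..a + \<rho>} \<Longrightarrow> \<bar>t - s\<bar> \<le> \<rho>"
      proof (cases "s \<le> 1 / 2")
        case True then show thesis using s r2 by (intro that[of s]) auto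
      next
        case False then show thesis using s r2 by (intro that[of "s - \<rho>"]) auto
      qed
      have sub: "{a..a + \<rho>} \<subseteq> {0..1}" using a by auto
      have int_a: "(\<lambda>t. D t powr (- q - 1)) integrable_on {a..a + \<rho>}"
        using intD integrable_on_subinterval sub by blast
      have "((1 + L) * \<rho>) powr (- q - 1) \<le> D t powr (- q - 1)" if t: "t \<in> {a..a + \<rho>}" for t
      proof (rule powr_mono2')
        have t01: "t \<in> {0..1}" using sub t by blast
        show "0 < D t" by (rule Dpos[OF t01])
        have "D t = norm (\<nu> - (H t - H s))" by (simp add: D_def \<nu>_def)
        also have "\<dots> \<le> \<rho> + L * \<bar>t - s\<bar>"
          unfolding \<rho>_def using L(2)[OF s t01] norm_triangle_ineq4[of \<nu> "H t - H s"] by linarith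
        also have "\<dots> \<le> (1 + L) * \<rho>"
          using mult_left_mono[OF a(3)[OF t], of L] L(1) by (simp add: algebra_simps)
        finally show "D t \<le> (1 + L) * \<rho>" .
      qed (use q in simp)
      then have "integral {a..a + \<rho>} (\<lambda>t. ((1 + L) * \<rho>) powr (- q - 1)) \<le> integral {a..a + \<rho>} (\<lambda>t. D t powr (- q - 1))"
        by (intro integral_le int_a) auto
      also have "\<dots> \<le> integral {0..1} (\<lambda>t. D t powr (- q - 1))"
        by (intro integral_subset_le sub int_a intD) auto
      also have "integral {a..a + \<rho>} (\<lambda>t. ((1 + L) * \<rho>) powr (- q - 1)) = c0 * \<rho> powr (- q)"
        using \<rho>(1) L(1) by (simp add: c0_def powr_mult powr_diff)
      finally show ?thesis .
    qed
    let ?F = "curve_force q H x"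
    have contF: "continuous_on {0..1} (\<lambda>t. (D t powr (- q - 1)) *\<^sub>R (x - H t))"
      using D0 by (intro continuous_intros contD continuous_H) auto
    have F: "?F = integral {0..1} (\<lambda>t. (D t powr (- q - 1)) *\<^sub>R (x - H t))"
      by (simp add: curve_force_def D_def)
    have "norm ?F \<le> integral {0..1} (\<lambda>t. \<rho> powr (2 - q) / \<rho> * (\<rho> / (D t)\<^sup>2))"
      unfolding F
    proof (intro integral_norm_bound_integral integrable_continuous_real[OF contF] integrable_on_mult_right intJ)
      fix t :: real assume t: "t \<in> {0..1}"
      have "norm ((D t powr (- q - 1)) *\<^sub>R (x - H t)) = D t powr (- q)"
        using Dpos[OF t] by (simp add: powr_diff flip: D_def)
      then show "norm ((D t powr (- q - 1)) *\<^sub>R (x - H t)) \<le> \<rho> powr (2 - q) / \<rho> * (\<rho> / (D t)\<^sup>2)"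
        using powr_le_of_ge(1)[OF \<rho>(1) \<rho>D[OF t] q] \<rho> by simp
    qed
    also have "\<dots> = \<rho> powr (2 - q) / \<rho> * J"
      unfolding J_def by (rule integral_mult_right)
    also have "\<dots> \<le> \<rho> powr (2 - q) / \<rho> * J0"
      using J \<rho> by (intro mult_left_mono) auto
    finally have "c * \<rho> * norm ?F \<le> c * \<rho> * (\<rho> powr (2 - q) / \<rho> * J0)"
      using c \<rho> by (intro mult_left_mono) auto
    then have upper: "c * \<rho> * norm ?F \<le> \<rho> powr (2 - q) * (c0 / 3)"
      using \<rho> J0 by (simp add: c_def mult.commute)
    have "?F \<bullet> \<nu> = integral {0..1} (\<lambda>t. D t powr (- q - 1) * ((x - H t) \<bullet> \<nu>))"
      unfolding F using integral_linear[OF integrable_continuous_real[OF contF] bounded_linear_inner_left[of \<nu>]]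
      by (simp add: o_def)
    moreover have "integral {0..1} (\<lambda>t. \<rho>\<^sup>2 * D t powr (- q - 1) - \<rho> powr (2 - q) * (C * \<beta> * (\<rho> / (D t)\<^sup>2) + C * \<rho> / \<beta>)) \<le>
      integral {0..1} (\<lambda>t. D t powr (- q - 1) * ((x - H t) \<bullet> \<nu>))"
    proof (rule integral_le)
      show "(\<lambda>t. \<rho>\<^sup>2 * D t powr (- q - 1) - \<rho> powr (2 - q) * (C * \<beta> * (\<rho> / (D t)\<^sup>2) + C * \<rho> / \<beta>)) integrable_on {0..1}"
        by (intro integrable_diff integrable_on_mult_right integrable_add intD intJ integrable_const_ivl)
      show "(\<lambda>t. D t powr (- q - 1) * ((x - H t) \<bullet> \<nu>)) integrable_on {0..1}"
        using integrable_linear[OF integrable_continuous_real[OF contF] bounded_linear_inner_left[of \<nu>]]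
        by (simp add: o_def)
      fix t :: real assume t: "t \<in> {0..1}"
      have "C * \<rho> * ((D t)\<^sup>2 * D t powr (- q - 1)) \<le> C * \<rho> * (\<rho> powr (2 - q) / D t)"
        using powr_le_of_ge(2)[OF \<rho>(1) \<rho>D[OF t] q] C \<rho> by (intro mult_left_mono) auto
      also have "\<dots> = C * \<rho> * \<rho> powr (2 - q) * (1 / D t)"
        by simp
      also have "\<dots> \<le> C * \<rho> * \<rho> powr (2 - q) * (\<beta> / (D t)\<^sup>2 + 1 / \<beta>)"
        using inverse_le_weighted[OF Dpos[OF t] \<beta>] C \<rho> by (intro mult_left_mono) auto
      finally have "C * \<rho> * ((D t)\<^sup>2 * D t powr (- q - 1)) \<le> \<rho> powr (2 - q) * (C * \<beta> * (\<rho> / (D t)\<^sup>2) + C * \<rho> / \<beta>)"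
        by (simp add: algebra_simps)
      moreover have "D t powr (- q - 1) * (\<rho>\<^sup>2 - C * \<rho> * (D t)\<^sup>2) \<le> D t powr (- q - 1) * ((x - H t) \<bullet> \<nu>)"
        using num[OF t] by (intro mult_left_mono) auto
      ultimately show "\<rho>\<^sup>2 * D t powr (- q - 1) - \<rho> powr (2 - q) * (C * \<beta> * (\<rho> / (D t)\<^sup>2) + C * \<rho> / \<beta>)
          \<le> D t powr (- q - 1) * ((x - H t) \<bullet> \<nu>)"
        by (simp add: algebra_simps)
    qed
    moreover have "integral {0..1} (\<lambda>t. \<rho>\<^sup>2 * D t powr (- q - 1) - \<rho> powr (2 - q) * (C * \<beta> * (\<rho> / (D t)\<^sup>2) + C * \<rho> / \<beta>)) =
      \<rho>\<^sup>2 * integral {0..1} (\<lambda>t. D t powr (- q - 1)) - \<rho> powr (2 - q) * (C * \<beta> * J + C * \<rho> / \<beta>)"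
    proof -
      have 1: "((\<lambda>t::real. C * \<rho> / \<beta>) has_integral C * \<rho> / \<beta>) {0..1}"
        using has_integral_const_real[of "C * \<rho> / \<beta>" 0 1] by simp
      show ?thesis
        unfolding J_def
        by (rule integral_unique, rule has_integral_diff[OF has_integral_mult_right[OF integrable_integral[OF intD]]
            has_integral_mult_right[OF has_integral_add[OF has_integral_mult_right[OF integrable_integral[OF intJ]] 1]]])
    qed
    moreover have "\<rho> powr (2 - q) * (c0 / 3) \<le>
      \<rho>\<^sup>2 * integral {0..1} (\<lambda>t. D t powr (- q - 1)) - \<rho> powr (2 - q) * (C * \<beta> * J + C * \<rho> / \<beta>)"
    proof -
      have "C * \<beta> * J \<le> C * \<beta> * J0"
        using J C \<beta> by (intro mult_left_mono) auto
      then have "C * \<beta> * J \<le> c0 / 3"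
        using C J0 by (simp add: \<beta>_def)
      moreover have "C * \<rho> / \<beta> \<le> c0 / 3"
      proof -
        have "\<rho> \<le> c0 * \<beta> / (3 * C)" using \<rho> by (simp add: r_def)
        then show ?thesis using C \<beta> by (simp add: field_simps)
      qed
      ultimately have "\<rho> powr (2 - q) * (C * \<beta> * J + C * \<rho> / \<beta>) \<le> \<rho> powr (2 - q) * (2 * c0 / 3)"
        by (intro mult_left_mono) auto
      moreover have "\<rho> powr (2 - q) * c0 \<le> \<rho>\<^sup>2 * integral {0..1} (\<lambda>t. D t powr (- q - 1))"
      proof -
        have "\<rho> powr (2 - q) * c0 = \<rho>\<^sup>2 * (c0 * \<rho> powr (- q))"
          using \<rho>(1) by (simp add: powr_diff powr_minus_divide powr_numeral)
        then show ?thesis using mult_left_mono[OF lower, of "\<rho>\<^sup>2"] by (simp only: zero_le_power2)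
      qed
      moreover have "\<rho> powr (2 - q) * (c0 / 3) = \<rho> powr (2 - q) * c0 - \<rho> powr (2 - q) * (2 * c0 / 3)"
        by (simp add: algebra_simps)
      ultimately show ?thesis by linarith
    qed
    ultimately have F\<nu>: "\<rho> powr (2 - q) * (c0 / 3) \<le> ?F \<bullet> \<nu>"
      by linarith
    moreover have "0 < \<rho> powr (2 - q) * (c0 / 3)"
      using \<rho> c0 by simp
    ultimately have "?F \<noteq> 0"
      by auto
    moreover have "c * \<rho> * norm ?F \<le> ?F \<bullet> \<nu>"
      using F\<nu> upper by linarith
    ultimately show "?F \<noteq> 0 \<and> c * norm (x - H s) * norm ?F \<le> ?F \<bullet> (x - H s)"
      by (simp add: \<rho>_def \<nu>_def)
  qed
qed

section \<open>Extended tangent field and tube\<close>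

lemma tangent_extension:
  obtains g where "continuous_on UNIV g" "\<And>t. t \<in> {0..1} \<Longrightarrow> g (H t) = H' t"
proof -
  \<comment> \<open>The only coincidence to check is the seam, where \<open>closed_H'\<close>
    applies; so the tangent descends to the curve and extends by Tietze.\<close>
  have "H' s = H' t" if "s \<in> {0..1}" "t \<in> {0..1}" "H s = H t" for s t
    using loop_free that closed_H' unfolding loop_free_def by metis
  then obtain g0 where g0: "continuous_on (path_image H) g0" "\<And>t. t \<in> {0..1} \<Longrightarrow> g0 (H t) = H' t"
    using continuous_on_factor_compact[OF compact_Icc continuous_H continuous_H'] unfolding path_image_def by metis
  have "closedin (top_of_set UNIV) (path_image H)"
    using continuous_H by (simp add: closed_path_image path_def)
  then obtain g where "continuous_on UNIV g" "\<And>x. x \<in> path_image H \<Longrightarrow> g x = g0 x"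
    using Tietze_unbounded[OF g0(1)] by blast
  with g0 show thesis
    by (intro that[of g]) (auto simp: path_image_def)
qed

lemma tube_exists:
  assumes q: "2 \<le> q"
  obtains U g where "open U" "bounded U" "path_image H \<subseteq> U" "continuous_on UNIV g"
    "\<And>x. x \<in> U \<Longrightarrow> g x \<noteq> 0"
    "\<And>x. x \<in> frontier U \<Longrightarrow> x \<notin> path_image H"
    "\<And>x. x \<in> frontier U \<Longrightarrow> curve_force q H x \<noteq> 0"
    "\<And>x. x \<in> frontier U \<Longrightarrow> 0 \<notin> closed_segment ((1 - q) *\<^sub>R curve_force q H x) (g x)"
proof -
  let ?\<Gamma> = "path_image H"
  obtain m where m: "0 < m" "\<And>t. t \<in> {0..1} \<Longrightarrow> m \<le> norm (H' t)"
    using speed_bounds by metis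
  obtain c r where c: "0 < c" and r: "0 < r" and est: "\<And>s x. s \<in> {0..1} \<Longrightarrow> x \<noteq> H s \<Longrightarrow> norm (x - H s) \<le> r \<Longrightarrow>
      (\<And>t. t \<in> {0..1} \<Longrightarrow> norm (x - H s) \<le> norm (x - H t)) \<Longrightarrow>
      curve_force q H x \<noteq> 0 \<and>
      c * norm (x - H s) * norm (curve_force q H x) \<le> curve_force q H x \<bullet> (x - H s)"
    using force_estimate[OF q] by blast
  obtain g where g: "continuous_on UNIV g" "\<And>t. t \<in> {0..1} \<Longrightarrow> g (H t) = H' t"
    using tangent_extension by blast
  \<comment> \<open>The bound m / 2 keeps \<open>g\<close> away from 0 on the tube; c * m / 4 makes
    the normal part of \<open>g\<close> too small for the angle guaranteed by c, even after its norm
    has dropped to \<open>m - \<eta>\<close>.\<close>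
  define \<eta> where "\<eta> = min (m / 2) (c * m / 4)"
  have \<eta>: "0 < \<eta>" "\<eta> < m" "\<eta> < c * (m - \<eta>)"
  proof -
    show "0 < \<eta>" "\<eta> < m" using m c by (auto simp: \<eta>_def)
    have "\<eta> \<le> c * m / 4" by (simp add: \<eta>_def)
    also have "\<dots> < c * (m / 2)" using m c by simp
    also have "\<dots> \<le> c * (m - \<eta>)" using c by (intro mult_left_mono) (auto simp: \<eta>_def)
    finally show "\<eta> < c * (m - \<eta>)" .
  qed
  have cpt: "compact ?\<Gamma>" and ne: "?\<Gamma> \<noteq> {}"
    using continuous_H by (auto simp: compact_path_image path_def)
  obtain B where B: "\<And>y. y \<in> ?\<Gamma> \<Longrightarrow> norm y \<le> B"
    using compact_imp_bounded[OF cpt] unfolding bounded_iff by blast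
  \<comment> \<open>Radius B + 1 contains the tube, whose width will be at most 1.\<close>
  have "uniformly_continuous_on (cball 0 (B + 1)) g"
    by (rule compact_uniformly_continuous) (use g(1) continuous_on_subset in auto)
  then obtain d where d: "0 < d" "\<And>x y. x \<in> cball 0 (B + 1) \<Longrightarrow> y \<in> cball 0 (B + 1) \<Longrightarrow> dist y x < d \<Longrightarrow> dist (g y) (g x) < \<eta>"
    using \<eta>(1) unfolding uniformly_continuous_on_def by metis
  define \<epsilon> where "\<epsilon> = min (min 1 r) (d / 2)"
  have \<epsilon>: "0 < \<epsilon>" "\<epsilon> \<le> 1" "\<epsilon> \<le> r" "\<epsilon> < d"
    using r d(1) by (auto simp: \<epsilon>_def)
  define U where "U = {x. infdist x ?\<Gamma> < \<epsilon>}"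
  have foot: "\<exists>s\<in>{0..1}. norm (x - H s) = infdist x ?\<Gamma> \<and> (\<forall>t\<in>{0..1}. norm (x - H s) \<le> norm (x - H t))" for x
  proof -
    obtain y where y: "y \<in> ?\<Gamma>" "infdist x ?\<Gamma> = dist x y"
      using infdist_attains_inf[OF compact_imp_closed[OF cpt] ne] by blast
    then obtain s where s: "s \<in> {0..1}" "y = H s" by (auto simp: path_image_def)
    have "norm (x - H s) \<le> norm (x - H t)" if "t \<in> {0..1}" for t
      using infdist_le[of "H t" ?\<Gamma> x] that y s by (auto simp: path_image_def dist_norm)
    with s y show ?thesis by (auto simp: dist_norm)
  qed
  have close: "norm (g x - H' s) < \<eta>" if "s \<in> {0..1}" "norm (x - H s) \<le> \<epsilon>" for x s
  proof -
    have "H s \<in> ?\<Gamma>" using that by (auto simp: path_image_def)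
    then have "norm (H s) \<le> B" by (rule B)
    moreover have "norm x \<le> norm (H s) + norm (x - H s)" by (metis norm_triangle_sub)
    ultimately have "x \<in> cball 0 (B + 1)" "H s \<in> cball 0 (B + 1)"
      using that(2) \<epsilon> by (auto simp: mem_cball_0)
    then show ?thesis
      using d(2)[of "H s" x] that \<epsilon> g(2)[OF that(1)] by (simp add: dist_norm)
  qed
  have g_big: "m - \<eta> < norm (g x)" if "s \<in> {0..1}" "norm (x - H s) \<le> \<epsilon>" for x s
  proof -
    have "norm (H' s) \<le> norm (g x) + norm (g x - H' s)"
      by (metis norm_minus_commute norm_triangle_sub)
    then show ?thesis using close[OF that] m(2)[OF that(1)] by linarith
  qed
  have "open U"
    unfolding U_def by (intro open_Collect_less continuous_intros)
  have "closure U \<subseteq> {x. infdist x ?\<Gamma> \<le> \<epsilon>}"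
    by (rule closure_minimal) (auto simp: U_def intro!: closed_Collect_le continuous_intros)
  then have fr: "infdist x ?\<Gamma> = \<epsilon>" if "x \<in> frontier U" for x
    using that interior_open[OF \<open>open U\<close>] unfolding frontier_def U_def by fastforce
  have frontier_facts: "curve_force q H x \<noteq> 0 \<and> 0 \<notin> closed_segment ((1 - q) *\<^sub>R curve_force q H x) (g x)"
    if x: "x \<in> frontier U" for x
  proof -
    obtain s where s: "s \<in> {0..1}" "norm (x - H s) = \<epsilon>" "\<And>t. t \<in> {0..1} \<Longrightarrow> norm (x - H s) \<le> norm (x - H t)"
      using foot[of x] fr[OF x] by auto
    let ?F = "curve_force q H x" and ?\<nu> = "x - H s"
    have "?F \<noteq> 0 \<and> c * norm ?\<nu> * norm ?F \<le> ?F \<bullet> ?\<nu>"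
      using \<epsilon> s(2) by (intro est s) auto
    then have F: "?F \<noteq> 0" and F\<nu>: "c * \<epsilon> * norm ?F \<le> ?F \<bullet> ?\<nu>"
      using s(2) by auto
    have "0 \<notin> closed_segment ((1 - q) *\<^sub>R ?F) (g x)"
    proof
      assume "0 \<in> closed_segment ((1 - q) *\<^sub>R ?F) (g x)"
      then obtain u where u: "0 \<le> u" "u \<le> 1" "0 = (1 - u) *\<^sub>R ((1 - q) *\<^sub>R ?F) + u *\<^sub>R g x"
        by (auto simp: in_segment)
      define a where "a = (1 - u) * (q - 1)"
      have a: "0 \<le> a" using u q by (simp add: a_def)
      \<comment> \<open>Because 1 - q is negative, a zero on the segment gives a nonnegative factor
        a. Pairing with the normal then bounds \<open>c * norm (g x)\<close> by \<eta> unless u = 0,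
        and u = 0 would make the force vanish.\<close>
      have eq: "u *\<^sub>R g x = a *\<^sub>R ?F"
        using u(3) by (simp add: a_def algebra_simps)
      have "u * norm (g x) = a * norm ?F"
        using arg_cong[OF eq, of norm] u a by simp
      then have "c * \<epsilon> * (u * norm (g x)) = a * (c * \<epsilon> * norm ?F)"
        by simp
      also have "\<dots> \<le> a * (?F \<bullet> ?\<nu>)"
        by (intro mult_left_mono F\<nu> a)
      also have "\<dots> = u * (g x \<bullet> ?\<nu>)"
        using arg_cong[OF eq, of "\<lambda>v. v \<bullet> ?\<nu>"] by simp
      also have "\<dots> \<le> u * (\<eta> * \<epsilon>)"
      proof (intro mult_left_mono u(1))
        have "?\<nu> \<bullet> H' s = 0" by (rule nearest_point_orthogonal[OF s(1,3)])
        then have "g x \<bullet> ?\<nu> = (g x - H' s) \<bullet> ?\<nu>" using inner_diff_left[of "g x" "H' s" ?\<nu>] inner_commute[of ?\<nu> "H' s"] by linarith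
        also have "\<dots> \<le> norm (g x - H' s) * \<epsilon>" using norm_cauchy_schwarz[of "g x - H' s" ?\<nu>] s(2) by simp
        also have "\<dots> \<le> \<eta> * \<epsilon>" using close[of s x] s \<epsilon> by (intro mult_right_mono) auto
        finally show "g x \<bullet> ?\<nu> \<le> \<eta> * \<epsilon>" .
      qed
      finally have "\<epsilon> * (u * (c * norm (g x))) \<le> \<epsilon> * (u * \<eta>)"
        by (simp add: mult_ac)
      then have le: "u * (c * norm (g x)) \<le> u * \<eta>"
        using \<epsilon>(1) by simp
      have "\<eta> < c * norm (g x)"
        using \<eta>(3) mult_strict_left_mono[OF g_big[of s x] c] s by auto
      with le u(1) have "u = 0"
        by (metis less_eq_real_def mult_less_cancel_left_pos not_le)
      then have "(1 - q) *\<^sub>R ?F = 0" using u(3) by simp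
      with F q show False by simp
    qed
    with F show ?thesis by blast
  qed
  show thesis
  proof (rule that[OF \<open>open U\<close> _ _ g(1)])
    show "bounded U"
      unfolding bounded_iff
    proof (intro exI ballI)
      fix x assume "x \<in> U"
      then obtain s where s: "s \<in> {0..1}" "norm (x - H s) < \<epsilon>"
        using foot[of x] by (auto simp: U_def)
      have "norm (H s) \<le> B" using s by (intro B) (auto simp: path_image_def)
      then show "norm x \<le> B + 1"
        using norm_triangle_sub[of x "H s"] s \<epsilon> by linarith
    qed
    show "?\<Gamma> \<subseteq> U" using \<epsilon> by (auto simp: U_def)
    show "g x \<noteq> 0" if "x \<in> U" for x
      using foot[of x] that g_big[of _ x] \<eta> by (fastforce simp: U_def)
    show "x \<notin> ?\<Gamma>" if "x \<in> frontier U" for x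
      using fr[OF that] \<epsilon> by auto
  qed (use frontier_facts in blast)+
qed

end

section \<open>From the periodic embedded curve to the conclusion\<close>

lemma regular_closed_curve_of_C2:
  fixes H :: "real \<Rightarrow> 'a::euclidean_space"
  assumes "periodic_C2_curve H" "embedded_closed_curve H"
  obtains H' M where "regular_closed_curve H H' M"
proof -
  obtain H' H'' where H': "\<And>t. t \<in> {0..1} \<Longrightarrow> (H has_vector_derivative H' t) (at t within {0..1})"
    and H'': "\<And>t. t \<in> {0..1} \<Longrightarrow> (H' has_vector_derivative H'' t) (at t within {0..1})"
    and cont: "continuous_on {0..1} H''" and closed: "H 0 = H 1" "H' 0 = H' 1"
    using assms(1) unfolding periodic_C2_curve_def by blast
  \<comment> \<open>The bound on the second derivative becomes the Lipschitz constant of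
    \<open>H'\<close> by the mean value inequality.\<close>
  obtain b where b: "0 < b" "\<And>t. t \<in> {0..1} \<Longrightarrow> norm (H'' t) \<le> b"
    using compact_imp_bounded[OF compact_continuous_image[OF cont compact_Icc]]
    unfolding bounded_pos by blast
  show thesis
  proof (rule that[of H' b], unfold_locales)
    show "norm (H' t - H' s) \<le> b * \<bar>t - s\<bar>" if "s \<in> {0..1}" "t \<in> {0..1}" for s t
    proof -
      have "norm (H' t - H' s) \<le> b * norm (t - s)"
      proof (rule differentiable_bound[of "{0..1}" H' "\<lambda>x h. h *\<^sub>R H'' x"])
        show "(H' has_derivative (\<lambda>h. h *\<^sub>R H'' x)) (at x within {0..1})" if "x \<in> {0..1}" for x
          using H''[OF that] by (simp add: has_vector_derivative_def)
        show "onorm (\<lambda>h. h *\<^sub>R H'' x) \<le> b" if "x \<in> {0..1}" for x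
          using b that by (intro onorm_le) (simp add: mult.commute[of b] mult_left_mono)
      qed (use that in auto)
      then show ?thesis by simp
    qed
    show "loop_free H" using assms(2) by (simp add: embedded_closed_curve_def)
    show "H' t \<noteq> 0" if "t \<in> {0..1}" for t
      using assms(2) vector_derivative_within_closed_interval[OF _ that H'[OF that]] that
      by (auto simp: embedded_closed_curve_def)
  qed (use H' b closed in auto)
qed

theorem theorem5p2:
  fixes H :: "real \<Rightarrow> real^'n" and q :: real
  assumes "CARD('n) > 3" and "q \<ge> 2"
    and "periodic_C2_curve H"
    and "embedded_closed_curve H"
  shows "\<exists>U. open U \<and> bounded U \<and> path_image H \<subseteq> U \<and>
    (\<forall>x\<in>frontier U. gradient (curve_potential q H) x \<noteq> 0) \<and>
    boundary_degree (gradient (curve_potential q H)) U 0 = 0"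
proof -
  obtain H' M where "regular_closed_curve H H' M"
    using regular_closed_curve_of_C2 assms(3,4) by blast
  then interpret regular_closed_curve H H' M .
  obtain U g where U: "open U" "bounded U" "path_image H \<subseteq> U"
    and g: "continuous_on UNIV g" "\<And>x. x \<in> U \<Longrightarrow> g x \<noteq> 0"
    and off: "\<And>x. x \<in> frontier U \<Longrightarrow> x \<notin> path_image H"
    and F: "\<And>x. x \<in> frontier U \<Longrightarrow> curve_force q H x \<noteq> 0"
    and seg: "\<And>x. x \<in> frontier U \<Longrightarrow> 0 \<notin> closed_segment ((1 - q) *\<^sub>R curve_force q H x) (g x)"
    using tube_exists[OF assms(2)] by blast
  let ?G = "gradient (curve_potential q H)"
  have G: "?G x = (1 - q) *\<^sub>R curve_force q H x" if "x \<in> frontier U" for x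
    using gradient_curve_potential[OF continuous_H off[OF that]] .
  have "continuous_on (frontier U) (\<lambda>x. (1 - q) *\<^sub>R curve_force q H x)"
    using off by (intro continuous_intros continuous_on_subset[OF continuous_on_curve_force[OF continuous_H]]) auto
  then have "continuous_on (frontier U) ?G"
    by (rule continuous_on_eq) (simp add: G)
  then have "boundary_degree ?G U 0 = 0"
    using U g seg G by (intro boundary_degree_eq_0[where g = g]) (auto intro: continuous_on_subset)
  moreover have "\<forall>x\<in>frontier U. ?G x \<noteq> 0"
    using G F assms(2) by simp
  ultimately show ?thesis
    using U by blast
qed

end
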